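(* Let $\ell,T>0$ and let $P,Q\in C^1[0,\ell]$ be complex-valued. Let $u,\widetilde{u}\in C^{1,2}([0,T]\times[0,\ell])$ satisfy $$\sqrt{-1}\,\partial_tu=\partial_x^2u-P(x)u,\qquad \partial_xu(t,0)=0,\qquad 0<x<\ell,\ 0<t<T,$$ $$\sqrt{-1}\,\partial_t\widetilde{u}=\partial_x^2\widetilde{u}-Q(x)\widetilde{u},\qquad \partial_x\widetilde{u}(t,0)=0,\qquad 0<x<\ell,\ 0<t<T.$$ If $u(t,0)=\widetilde{u}(t,0)$ for all $t\in(0,T)$ and $u(0,\cdot)=\widetilde{u}(0,\cdot)=:a\in\mathcal{A}$, then $P=Q$ on $[0,\ell]$.
   Context: $C^{1,2}([0,T]\times[0,\ell])$ denotes the set of (complex-valued) $u\in C([0,T]\times[0,\ell])$ such that $\partial_tu,\partial_xu,\partial_x^2u\in C([0,T]\times[0,\ell])$. $\mathcal{A}:=\{a\in H^3(0,\ell):\ a'(0)=0,\ a>0\text{ on }[0,\ell]\}$, where $H^3(0,\ell)$ is the usual Sobolev space and $a'=\frac{da}{dx}$. *)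

theory Defs
  imports "HOL-Analysis.Analysis"
begin

text \<open>
  Derivatives on a closed interval are taken within that interval, so they are one-sided at the
  end points and agree with the usual ones in the interior. Values outside the interval, or
  outside the rectangle, never matter.
\<close>

definition C1_interval :: "real \<Rightarrow> (real \<Rightarrow> complex) set" where
  "C1_interval l = {P. (\<forall>x\<in>{0..l}. P differentiable (at x within {0..l})) \<and>
     continuous_on {0..l} (\<lambda>x. vector_derivative P (at x within {0..l}))}"

definition partial_t :: "real \<Rightarrow> (real \<Rightarrow> real \<Rightarrow> complex) \<Rightarrow> real \<Rightarrow> real \<Rightarrow> complex" where
  "partial_t T u t x = vector_derivative (\<lambda>s. u s x) (at t within {0..T})"

definition partial_x :: "real \<Rightarrow> (real \<Rightarrow> real \<Rightarrow> complex) \<Rightarrow> real \<Rightarrow> real \<Rightarrow> complex" where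
  "partial_x l u t x = vector_derivative (\<lambda>y. u t y) (at x within {0..l})"

definition C12 :: "real \<Rightarrow> real \<Rightarrow> (real \<Rightarrow> real \<Rightarrow> complex) set" where
  "C12 T l = {u.
     (\<forall>t\<in>{0..T}. \<forall>x\<in>{0..l}.
        (\<lambda>s. u s x) differentiable (at t within {0..T}) \<and>
        (\<lambda>y. u t y) differentiable (at x within {0..l}) \<and>
        (\<lambda>y. partial_x l u t y) differentiable (at x within {0..l})) \<and>
     continuous_on ({0..T} \<times> {0..l}) (\<lambda>(t, x). u t x) \<and>
     continuous_on ({0..T} \<times> {0..l}) (\<lambda>(t, x). partial_t T u t x) \<and>
     continuous_on ({0..T} \<times> {0..l}) (\<lambda>(t, x). partial_x l u t x) \<and>
     continuous_on ({0..T} \<times> {0..l}) (\<lambda>(t, x). partial_x l (partial_x l u) t x)}"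

definition test_functions :: "real \<Rightarrow> (real \<Rightarrow> real) set" where
  "test_functions l = {\<phi>. (\<forall>n x. (deriv ^^ n) \<phi> field_differentiable (at x)) \<and>
     closure {x. \<phi> x \<noteq> 0} \<subseteq> {0<..<l}}"

definition L2_interval :: "real \<Rightarrow> (real \<Rightarrow> real) set" where
  "L2_interval l = {f. f \<in> borel_measurable (lebesgue_on {0<..<l}) \<and>
     integrable (lebesgue_on {0<..<l}) (\<lambda>x. (f x)\<^sup>2)}"

definition weak_derivative :: "real \<Rightarrow> nat \<Rightarrow> (real \<Rightarrow> real) \<Rightarrow> (real \<Rightarrow> real) \<Rightarrow> bool" where
  "weak_derivative l k f g \<longleftrightarrow> (\<forall>\<phi>\<in>test_functions l.
     (LINT x|lebesgue_on {0<..<l}. f x * (deriv ^^ k) \<phi> x) =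
     (-1) ^ k * (LINT x|lebesgue_on {0<..<l}. g x * \<phi> x))"

text \<open>Elements are functions, not classes of functions equal almost everywhere.\<close>

definition Sobolev_H :: "nat \<Rightarrow> real \<Rightarrow> (real \<Rightarrow> real) set" where
  "Sobolev_H m l = {f \<in> L2_interval l.
     \<forall>k\<in>{1..m}. \<exists>g\<in>L2_interval l. weak_derivative l k f g}"

text \<open>
  The pointwise conditions on \<open>a\<close> refer to the continuous representative of an element of
  \<open>H\<^sup>3(0,l)\<close> (which is in fact of class \<open>C\<^sup>2\<close> on the closed interval); the continuity clause
  selects it.
\<close>

definition admissible :: "real \<Rightarrow> (real \<Rightarrow> real) set" where
  "admissible l = {a \<in> Sobolev_H 3 l. continuous_on {0..l} a \<and>
     (a has_real_derivative 0) (at 0 within {0..l}) \<and>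
     (\<forall>x\<in>{0..l}. a x > 0)}"

end

theory Submission
  imports Defs
begin

text \<open>
  A Gelfand--Levitan transformation operator \<open>S\<close> intertwines \<open>\<partial>\<^sub>x\<^sup>2 - P\<close> and \<open>\<partial>\<^sub>x\<^sup>2 - Q\<close> on even functions
  and preserves the value at \<open>0\<close>, so \<open>v = S u - u'\<close> solves the equation with potential \<open>Q\<close> and has
  vanishing Cauchy data on \<open>x = 0\<close>; hence \<open>v = 0\<close>, and at time \<open>0\<close> this says \<open>S a = a\<close>. Applying
  both operators to \<open>a\<close> gives \<open>(P - Q) a = S h - h\<close> with \<open>h = a'' - P a\<close>. Since \<open>S - 1\<close> is a
  Volterra operator with \<open>\<bar>(S h - h)(x)\<bar> \<le> C \<integral>\<^sub>0\<^sup>x \<bar>Q - P\<bar>\<close> and \<open>a > 0\<close>, Gronwall's inequality yields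
  \<open>P = Q\<close>. Instead of a Goursat kernel, \<open>S\<close> is obtained as a Duhamel series, which only needs
  continuous potentials.
\<close>

subsection \<open>Iterated primitives\<close>

text \<open>Read \<open>x\<close> as time and \<open>S\<close> as a family of functionals.
  Intertwining, together with \<open>S f 0 = f 0\<close> and \<open>(S f)' 0 = 0\<close>, is then
  the Cauchy problem \<open>(S f)'' = S f'' + (q * S f - S (p f))\<close>: a perturbed wave equation
  for functionals, whose unperturbed solution is evaluation at \<open>x\<close>. Duhamel's principle
  turns it into the integral equation behind the series, and finite propagation speed makes the
  value at \<open>x\<close> depend on \<open>f\<close> over \<open>{-x..x}\<close> only.
  Second-order equations in \<open>x\<close> are used in twice integrated form, with kernel
  \<open>x - s\<close>; Cauchy data at \<open>x = 0\<close> show up there as the constant term and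
  as the absence of a linear one.

  Weights in time that vanish to high order at both ends of a short interval absorb these
  derivatives instead; the potential does not depend on time and passes through.\<close>

definition prim :: "(real \<Rightarrow> 'a::euclidean_space) \<Rightarrow> real \<Rightarrow> 'a" where
  "prim f y = integral {0..y} f - integral {y..0} f"

lemma prim_diff:
  assumes "continuous_on UNIV f" "a \<le> b"
  shows "prim f b - prim f a = integral {a..b} f"
proof -
  have i: "f integrable_on {c..d}" for c d
    by (rule integrable_continuous_real[OF continuous_on_subset[OF assms(1)]]) auto
  have c: "integral {x..y} f + integral {y..z} f = integral {x..z} f" if "x \<le> y" "y \<le> z" for x y z
    using Henstock_Kurzweil_Integration.integral_combine[OF that i] .
  consider "0 \<le> a" | "a < 0" "0 \<le> b" | "b < 0" by linarith
  then show ?thesis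
  proof cases
    case 1
    then show ?thesis using c[of 0 a b] assms(2)
      by (cases "a = 0"; cases "b = 0") (auto simp: prim_def algebra_simps)
  next
    case 2
    then show ?thesis using c[of a 0 b]
      by (cases "b = 0") (auto simp: prim_def algebra_simps)
  next
    case 3
    then show ?thesis using c[of a b 0] assms(2)
      by (auto simp: prim_def algebra_simps)
  qed
qed

lemma prim_0 [simp]: "prim f 0 = 0"
  by (simp add: prim_def)

lemma prim_nonneg: "0 \<le> y \<Longrightarrow> prim f y = integral {0..y} f"
  by (cases "y = 0") (auto simp: prim_def)

lemma prim_has_derivative:
  assumes "continuous_on UNIV f"
  shows "(prim f has_vector_derivative f y) (at y within S)"
proof -
  have "((\<lambda>x. prim f (y - 1) + integral {y-1..x} f) has_vector_derivative f y) (at y within {y-1..y+1})"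
    using has_vector_derivative_add[OF has_vector_derivative_const
        integral_has_vector_derivative[OF continuous_on_subset[OF assms]]]
    by fastforce
  then have "(prim f has_vector_derivative f y) (at y within {y-1..y+1})"
    by (rule has_vector_derivative_transform[rotated 2]) (auto simp flip: prim_diff[OF assms])
  then have "(prim f has_vector_derivative f y) (at y within {y-1<..<y+1})"
    by (rule has_vector_derivative_within_subset) auto
  then have "(prim f has_vector_derivative f y) (at y)"
    by (simp add: at_within_open[of y "{y-1<..<y+1}"])
  then show ?thesis by (rule has_vector_derivative_at_within)
qed

lemma prim_continuous: "continuous_on UNIV f \<Longrightarrow> continuous_on S (prim f)"
  using has_vector_derivative_continuous prim_has_derivative
  by (metis continuous_on_eq_continuous_within)

lemma prim_lipschitz:
  assumes "continuous_on UNIV f" "\<And>x. norm (f x) \<le> B"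
  shows "norm (prim f b - prim f a) \<le> B * \<bar>b - a\<bar>"
proof -
  have *: "norm (prim f b - prim f a) \<le> B * \<bar>b - a\<bar>" if "a \<le> b" for a b
    unfolding prim_diff[OF assms(1) that]
    using integral_bound[OF that continuous_on_subset[OF assms(1)], of B] assms(2) that by auto
  show ?thesis using *[of a b] *[of b a] by (cases "a \<le> b") (auto simp: norm_minus_commute abs_minus_commute)
qed

lemma prim_add:
  assumes "continuous_on UNIV f" "continuous_on UNIV g"
  shows "prim (\<lambda>x. f x + g x) y = prim f y + prim g y"
  unfolding prim_def
  by (subst (1 2) Henstock_Kurzweil_Integration.integral_add)
     (auto intro!: integrable_continuous_real continuous_on_subset[OF assms(1)] continuous_on_subset[OF assms(2)])

lemma prim_minus: "prim (\<lambda>x. f (- x)) y = - prim f (- y)"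
  using Henstock_Kurzweil_Integration.integral_reflect_real[of "-y" 0 f]
    Henstock_Kurzweil_Integration.integral_reflect_real[of 0 "-y" f]
  by (simp add: prim_def)

text \<open>Cauchy's formula for repeated integration; \<open>(x - y) *\<^sub>R prim f y\<close> is
  a primitive of \<open>(x - y) *\<^sub>R f y - prim f y\<close> and vanishes at both ends.\<close>

lemma prim_taylor:
  assumes c: "continuous_on UNIV f" and "0 \<le> x"
  shows "prim (prim f) x = integral {0..x} (\<lambda>y. (x - y) *\<^sub>R f y)"
proof -
  have "((\<lambda>y. (x - y) *\<^sub>R f y - prim f y) has_integral ((x - x) *\<^sub>R prim f x - (x - 0) *\<^sub>R prim f 0)) {0..x}"
    by (rule fundamental_theorem_of_calculus)
       (auto intro!: derivative_eq_intros prim_has_derivative[OF c] simp: assms)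
  then have *: "((\<lambda>y. (x - y) *\<^sub>R f y - prim f y) has_integral 0) {0..x}" by simp
  have "(prim f has_integral prim (prim f) x) {0..x}"
    using assms by (simp add: prim_nonneg integrable_integral integrable_continuous_real prim_continuous)
  from has_integral_add[OF * this] show ?thesis by (simp add: integral_unique)
qed

lemma integral_monomial:
  assumes "0 \<le> x"
  shows "integral {0..x} (\<lambda>s :: real. s ^ k) = x ^ Suc k / Suc k"
proof -
  have "((\<lambda>s. s ^ k) has_integral (x ^ Suc k / Suc k - 0 ^ Suc k / Suc k)) {0..x}"
    using assms
    by (intro fundamental_theorem_of_calculus)
       (auto intro!: derivative_eq_intros simp flip: has_real_derivative_iff_has_vector_derivative simp del: power_Suc)
  then show ?thesis by (simp add: integral_unique)
qed

lemma integral_monomial_taylor: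
  assumes "0 \<le> x"
  shows "integral {0..x} (\<lambda>s :: real. (x - s) * (s ^ k / fact k)) = x ^ (k + 2) / fact (k + 2)"
proof -
  have "(\<lambda>s. (x - s) * (s ^ k / fact k)) = (\<lambda>s. x / fact k * s ^ k - s ^ Suc k / fact k)"
    by (simp add: fun_eq_iff field_simps)
  moreover have "integral {0..x} (\<lambda>s. x / fact k * s ^ k - s ^ Suc k / fact k)
      = x / fact k * (x ^ Suc k / Suc k) - x ^ Suc (Suc k) / Suc (Suc k) / fact k"
    by (subst Henstock_Kurzweil_Integration.integral_diff)
       (auto simp: integral_monomial assms simp del: power_Suc intro!: integrable_continuous_real continuous_intros)
  moreover have "x / F * (x * y / (1 + r)) - x * (x * y) / (2 + r) / F = x * (x * y) / ((2 + r) * ((1 + r) * F))"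
    if "r \<ge> 0" "F > 0" for r F y :: real
    using that by (simp add: divide_simps) (simp add: algebra_simps)
  from this[of k "fact k" "x ^ k"]
  have "x / fact k * (x ^ Suc k / Suc k) - x ^ Suc (Suc k) / Suc (Suc k) / fact k = x ^ (k + 2) / fact (k + 2)"
    by (simp add: add.commute)
  ultimately show ?thesis by (simp only:)
qed

subsection \<open>Wave propagation on bounded continuous functions\<close>

text \<open>Integrals with values in this space are taken later: superpositions of waves, and even
  extensions integrated over time.\<close>

instance bcontfun :: (metric_space, banach) banach ..

lemma continuous_on_bcontfun_eval:
  "continuous_on S (\<lambda>(x, f :: 'a::metric_space \<Rightarrow>\<^sub>C 'b::real_normed_vector). f x)"
proof -
  have "((\<lambda>z. apply_bcontfun (snd z) (fst z)) \<longlongrightarrow> f x) (at (x, f) within S)" for x and f :: "'a \<Rightarrow>\<^sub>C 'b"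
  proof (rule Lim_transform2)
    show "((\<lambda>z. f (fst z)) \<longlongrightarrow> f x) (at (x, f) within S)"
      by (rule tendsto_eq_intros continuous_on_tendsto_compose[OF continuous_on_apply_bcontfun[of UNIV f]] | simp)+
    show "((\<lambda>z. f (fst z) - apply_bcontfun (snd z) (fst z)) \<longlongrightarrow> 0) (at (x, f) within S)"
    proof (rule Lim_null_comparison[OF always_eventually], intro allI)
      show "((\<lambda>z. norm (f - snd z)) \<longlongrightarrow> 0) (at (x, f) within S)"
        by (rule tendsto_eq_intros | simp)+
      show "norm (f (fst z) - apply_bcontfun (snd z) (fst z)) \<le> norm (f - snd z)"
        for z :: "'a \<times> ('a \<Rightarrow>\<^sub>C 'b)"
        using norm_bounded[of "f - snd z" "fst z"] by simp
    qed
  qed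
  then show ?thesis
    by (auto simp: continuous_on_def case_prod_unfold)
qed

lemma bounded_linear_bcontfun_eval: "bounded_linear (\<lambda>f :: 'a::topological_space \<Rightarrow>\<^sub>C 'b::real_normed_vector. f x)"
  by (rule bounded_linear_intro[where K = 1]) (auto simp: norm_bounded)

definition bmult :: "('a::topological_space \<Rightarrow>\<^sub>C complex) \<Rightarrow> ('a \<Rightarrow>\<^sub>C complex) \<Rightarrow> ('a \<Rightarrow>\<^sub>C complex)" where
  "bmult p f = Bcontfun (\<lambda>x. p x * f x)"

lemma bmult_apply [simp]: "bmult p f x = p x * f x"
proof -
  have "(\<lambda>x. p x * f x) \<in> bcontfun"
    by (rule bcontfun_normI[where b = "norm p * norm f"])
       (auto intro!: continuous_intros mult_mono norm_bounded simp: norm_mult)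
  then show ?thesis by (simp add: bmult_def Bcontfun_inverse)
qed

lemma norm_bmult: "norm (bmult p f) \<le> norm p * norm f"
  by (rule norm_bound) (auto intro!: mult_mono norm_bounded simp: norm_mult)

lemma bounded_linear_bmult: "bounded_linear (bmult p)"
proof (rule bounded_linear_intro)
  show "norm (bmult p f) \<le> norm f * norm p" for f using norm_bmult[of p f] by (simp add: mult.commute)
  show "bmult p (f + g) = bmult p f + bmult p g" for f g
    by (rule bcontfun_eqI) (simp add: algebra_simps)
  show "bmult p (r *\<^sub>R f) = r *\<^sub>R bmult p f" for r f
    by (rule bcontfun_eqI) simp
qed

text \<open>
  For \<open>t \<ge> 0\<close> this is d'Alembert's solution of the wave equation with initial position \<open>0\<close> and
  initial velocity \<open>f\<close>. Setting it to \<open>0\<close> for \<open>t < 0\<close> keeps it continuous in \<open>t\<close> and lets the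
  Duhamel integrals below run over the fixed interval \<open>{0..l}\<close>.
\<close>

definition wave :: "real \<Rightarrow> (real \<Rightarrow>\<^sub>C complex) \<Rightarrow> (real \<Rightarrow>\<^sub>C complex)" where
  "wave t f = Bcontfun (\<lambda>z. (prim f (z + max t 0) - prim f (z - max t 0)) / 2)"

lemma prim_bcontfun_lipschitz: "norm (prim (apply_bcontfun f) b - prim f a) \<le> norm f * \<bar>b - a\<bar>"
  for f :: "real \<Rightarrow>\<^sub>C complex"
  by (rule prim_lipschitz) (auto simp: norm_bounded)

lemma wave_apply: "wave t f z = (prim f (z + max t 0) - prim f (z - max t 0)) / 2"
proof -
  have "(\<lambda>z. (prim f (z + max t 0) - prim f (z - max t 0)) / 2) \<in> bcontfun"
  proof (rule bcontfun_normI)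
    show "continuous_on UNIV (\<lambda>z. (prim f (z + max t 0) - prim f (z - max t 0)) / 2)"
      by (intro continuous_intros continuous_on_compose2[OF prim_continuous[of f UNIV]]) auto
    show "norm ((prim f (z + max t 0) - prim f (z - max t 0)) / 2) \<le> norm f * \<bar>max t 0\<bar>" for z
      using prim_bcontfun_lipschitz[of f "z + max t 0" "z - max t 0"] by (simp add: norm_divide)
  qed
  then show ?thesis by (simp add: wave_def Bcontfun_inverse)
qed

lemma norm_wave: "norm (wave t f) \<le> norm f * max t 0"
proof (rule norm_bound)
  show "norm (wave t f z) \<le> norm f * max t 0" for z
    using prim_bcontfun_lipschitz[of f "z + max t 0" "z - max t 0"] by (simp add: wave_apply norm_divide)
qed

lemma bounded_linear_wave: "bounded_linear (wave t)"
proof (rule bounded_linear_intro)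
  fix f g :: "real \<Rightarrow>\<^sub>C complex" and r
  show "wave t (f + g) = wave t f + wave t g"
    by (rule bcontfun_eqI) (simp add: wave_apply plus_bcontfun.rep_eq[abs_def] prim_add field_simps)
  show "wave t (r *\<^sub>R f) = r *\<^sub>R wave t f"
    by (rule bcontfun_eqI) (simp add: wave_apply prim_def algebra_simps scaleR_conv_of_real)
  show "norm (wave t f) \<le> norm f * max t 0"
    by (rule norm_wave)
qed

lemma wave_nonpos [simp]: "t \<le> 0 \<Longrightarrow> wave t f = 0"
  by (rule bcontfun_eqI) (simp add: wave_apply)

lemma wave_lipschitz: "norm (wave s f - wave t f) \<le> norm f * \<bar>s - t\<bar>"
proof (rule norm_bound)
  fix z
  have "(wave s f - wave t f) z = ((prim f (z + max s 0) - prim f (z + max t 0)) - (prim f (z - max s 0) - prim f (z - max t 0))) / 2"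
    by (simp add: wave_apply field_simps)
  also have "norm \<dots> \<le> (norm f * \<bar>max s 0 - max t 0\<bar> + norm f * \<bar>max s 0 - max t 0\<bar>) / 2"
    using norm_triangle_le_diff[OF add_mono[OF prim_bcontfun_lipschitz[of f "z + max s 0" "z + max t 0"] prim_bcontfun_lipschitz[of f "z - max s 0" "z - max t 0"]]]
    by (simp add: norm_divide abs_minus_commute)
  also have "\<dots> \<le> norm f * \<bar>s - t\<bar>"
    by (auto intro!: mult_left_mono)
  finally show "norm ((wave s f - wave t f) z) \<le> norm f * \<bar>s - t\<bar>" .
qed

lemma continuous_on_wave: "continuous_on S (\<lambda>(t, f). wave t f)"
proof -
  have "((\<lambda>z. wave (fst z) (snd z)) \<longlongrightarrow> wave t f) (at (t, f) within S)" for t f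
  proof (rule LIM_zero_cancel)
    have "((\<lambda>z. norm (snd z - f) * max (fst z) 0 + norm f * \<bar>fst z - t\<bar>) \<longlongrightarrow> 0) (at (t, f) within S)"
      by (rule tendsto_eq_intros | simp)+
    then show "((\<lambda>z. wave (fst z) (snd z) - wave t f) \<longlongrightarrow> 0) (at (t, f) within S)"
    proof (rule Lim_null_comparison[rotated], intro always_eventually allI)
      fix z
      have "wave (fst z) (snd z) - wave t f = wave (fst z) (snd z - f) + (wave (fst z) f - wave t f)"
        by (simp add: linear_diff[OF bounded_linear.linear[OF bounded_linear_wave]])
      then show "norm (wave (fst z) (snd z) - wave t f) \<le> norm (snd z - f) * max (fst z) 0 + norm f * \<bar>fst z - t\<bar>"
        using norm_triangle_mono[OF norm_wave wave_lipschitz] by metis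
    qed
  qed
  then show ?thesis
    by (auto simp: continuous_on_def case_prod_unfold)
qed

text \<open>Finite propagation speed: d'Alembert's formula reads \<open>f\<close> only on
  \<open>{z - t..z + t}\<close>, which lies in \<open>{-r..r}\<close>.\<close>

lemma wave_local:
  fixes f g :: "real \<Rightarrow>\<^sub>C complex"
  assumes "\<And>y. \<bar>y\<bar> \<le> r \<Longrightarrow> g y = c * f y" "\<bar>z\<bar> + t \<le> r"
  shows "wave t g z = c * wave t f z"
proof (cases "t \<le> 0")
  case False
  have "integral {z - t..z + t} g = integral {z - t..z + t} (\<lambda>y. c * f y)"
    by (rule integral_cong) (use assms in auto)
  with False show ?thesis
    by (simp add: wave_apply prim_diff)
qed auto

subsection \<open>The transformation operator\<close>

context
  fixes l :: real and p q :: "real \<Rightarrow>\<^sub>C complex"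
begin

text \<open>
  Treating \<open>x\<close> as time, \<open>S f\<close> solves \<open>S f x = f x + \<integral>\<^sub>0\<^sup>x R\<^sub>s (wave (x - s) f) ds\<close> where
  \<open>R\<^sub>s g = q s * S g s - S (p g) s\<close>; these are the terms of its Neumann series.
\<close>

primrec tterm :: "nat \<Rightarrow> real \<Rightarrow> (real \<Rightarrow>\<^sub>C complex) \<Rightarrow> complex" where
  "tterm 0 x f = f x"
| "tterm (Suc n) x f = integral {0..l}
     (\<lambda>s. q s * tterm n s (wave (x - s) f) - tterm n s (bmult p (wave (x - s) f)))"

definition tsource :: "nat \<Rightarrow> real \<Rightarrow> (real \<Rightarrow>\<^sub>C complex) \<Rightarrow> complex" where
  "tsource n s f = q s * tterm n s f - tterm n s (bmult p f)"

lemma tterm_Suc: "tterm (Suc n) x f = integral {0..l} (\<lambda>s. tsource n s (wave (x - s) f))"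
  by (simp add: tsource_def)

lemmas [simp del] = tterm.simps(2)

text \<open>Continuity must be joint for the induction to close: the integrand of the recursion
  moves the evaluation point and the function at once.\<close>

lemma continuous_on_tterm: "continuous_on S (\<lambda>(x, f). tterm n x f)"
proof -
  have "continuous_on UNIV (\<lambda>(x, f). tterm n x f)"
  proof (induction n)
    case 0
    then show ?case by (simp add: continuous_on_bcontfun_eval)
  next
    case (Suc n)
    note [continuous_intros] = continuous_on_compose2[OF Suc, where f = "\<lambda>z. (a z, b z)" for a b, simplified]
      continuous_on_compose2[OF continuous_on_wave[of UNIV], where f = "\<lambda>z. (a z, b z)" for a b, simplified]
      continuous_on_compose2[OF continuous_on_apply_bcontfun[of UNIV], simplified]
    have "continuous_on UNIV (\<lambda>z. integral (cbox 0 l) (\<lambda>s. tsource n s (wave (fst z - s) (snd z))))"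
      by (rule integral_continuous_on_param)
         (auto simp: tsource_def case_prod_unfold intro!: continuous_intros bounded_linear.continuous_on[OF bounded_linear_bmult])
    then show ?case by (simp add: tterm_Suc case_prod_unfold)
  qed
  then show ?thesis by (rule continuous_on_subset) auto
qed

lemma continuous_on_tterm_compose [continuous_intros]:
  "continuous_on S a \<Longrightarrow> continuous_on S b \<Longrightarrow> continuous_on S (\<lambda>z. tterm n (a z) (b z))"
  using continuous_on_compose2[OF continuous_on_tterm[of UNIV n], where f = "\<lambda>z. (a z, b z)"]
  by (simp add: continuous_on_Pair)

lemma continuous_on_wave_compose [continuous_intros]:
  "continuous_on S a \<Longrightarrow> continuous_on S b \<Longrightarrow> continuous_on S (\<lambda>z. wave (a z) (b z))"
  using continuous_on_compose2[OF continuous_on_wave[of UNIV], where f = "\<lambda>z. (a z, b z)"]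
  by (simp add: continuous_on_Pair)

lemma continuous_on_apply_compose [continuous_intros]:
  fixes f :: "real \<Rightarrow>\<^sub>C complex"
  shows "continuous_on S a \<Longrightarrow> continuous_on S (\<lambda>z. f (a z))"
  using continuous_on_compose2[OF continuous_on_apply_bcontfun[of UNIV f]] by simp

lemma continuous_on_tsource [continuous_intros]:
  "continuous_on S a \<Longrightarrow> continuous_on S b \<Longrightarrow> continuous_on S (\<lambda>z. tsource n (a z) (b z))"
  unfolding tsource_def
  by (intro continuous_intros bounded_linear.continuous_on[OF bounded_linear_bmult])

section \<open>Linearity and locality of the Neumann terms\<close>

lemma tterm_add: "tterm n x (f + g) = tterm n x f + tterm n x g"
proof (induction n arbitrary: x f g)
  case (Suc n)
  have "tsource n s (wave (x - s) (f + g)) = tsource n s (wave (x - s) f) + tsource n s (wave (x - s) g)" for s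
    by (simp add: tsource_def Suc linear_add[OF bounded_linear.linear[OF bounded_linear_wave]]
        linear_add[OF bounded_linear.linear[OF bounded_linear_bmult]] algebra_simps)
  then show ?case
    by (simp add: tterm_Suc)
       (rule Henstock_Kurzweil_Integration.integral_add; intro integrable_continuous_real continuous_intros)
qed auto

text \<open>
  For \<open>c = 1\<close> this says that only the values on \<open>{-x..x}\<close> matter; the factor \<open>c\<close> provides complex
  homogeneity, for which the type of bounded continuous functions has no scalar multiplication.
\<close>

lemma tterm_local:
  fixes f g :: "real \<Rightarrow>\<^sub>C complex"
  assumes "0 \<le> x" "\<And>y. \<bar>y\<bar> \<le> x \<Longrightarrow> g y = c * f y"
  shows "tterm n x g = c * tterm n x f"
  using assms
proof (induction n arbitrary: x f g)
  case 0
  then show ?case by simp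
next
  case (Suc n)
  have "tsource n s (wave (x - s) g) = c * tsource n s (wave (x - s) f)" if "s \<in> {0..l}" for s
  proof (cases "s \<le> x")
    case True
    \<comment> \<open>Here \<open>\<bar>y\<bar> + (x - s) \<le> x\<close>, so the wave stays inside
      the region where \<open>f\<close> and \<open>g\<close> are comparable and the induction
      hypothesis applies at \<open>s\<close>.\<close>
    have w: "wave (x - s) g y = c * wave (x - s) f y" if "\<bar>y\<bar> \<le> s" for y
      by (rule wave_local[where r = x]) (use Suc.prems True that in auto)
    show ?thesis
      using Suc.IH[of s "wave (x - s) g" "wave (x - s) f"]
        Suc.IH[of s "bmult p (wave (x - s) g)" "bmult p (wave (x - s) f)"] w that
      by (simp add: tsource_def algebra_simps)
  next
    case False
    have "tterm n s 0 = 0"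
      using tterm_add[of n s 0 0] by simp
    moreover have "bmult p 0 = 0" by (rule bcontfun_eqI) simp
    ultimately show ?thesis using False by (simp add: tsource_def)
  qed
  then have "tterm (Suc n) x g = integral {0..l} (\<lambda>s. c * tsource n s (wave (x - s) f))"
    unfolding tterm_Suc by (rule integral_cong)
  then show ?case
    by (simp add: tterm_Suc)
qed

lemma tterm_0 [simp]: "tterm n x 0 = 0"
  using tterm_add[of n x 0 0] by simp

lemma tsource_0 [simp]: "tsource n x 0 = 0"
  using linear_0[OF bounded_linear.linear[OF bounded_linear_bmult[of p]]] by (simp add: tsource_def)

lemma tterm_scaleR: "0 \<le> x \<Longrightarrow> tterm n x (r *\<^sub>R f) = r *\<^sub>R tterm n x f"
  using tterm_local[of x "r *\<^sub>R f" "of_real r" f n] by (simp add: scaleR_conv_of_real)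

section \<open>Factorial bounds for the Neumann terms\<close>

lemma tterm_Suc_upto:
  assumes "0 \<le> x" "x \<le> l"
  shows "tterm (Suc n) x f = integral {0..x} (\<lambda>s. tsource n s (wave (x - s) f))"
proof -
  have "integral {0..x} (\<lambda>s. tsource n s (wave (x - s) f)) + integral {x..l} (\<lambda>s. tsource n s (wave (x - s) f))
     = tterm (Suc n) x f"
    unfolding tterm_Suc
    by (rule Henstock_Kurzweil_Integration.integral_combine[OF assms])
       (intro integrable_continuous_real continuous_intros)
  moreover have "integral {x..l} (\<lambda>s. tsource n s (wave (x - s) f)) = integral {x..l} (\<lambda>s. 0)"
    by (rule integral_cong) simp
  ultimately show ?thesis by simp
qed

text \<open>One Duhamel step costs \<open>norm q + norm p\<close> for the source and at most
  \<open>l\<close> for the wave, and integrating \<open>s ^ k\<close> raises the power by one. The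
  free constant \<open>c\<close> lets the same step start from evaluation or from the first
  iterate.\<close>

lemma tterm_bound_step:
  assumes x: "0 \<le> x" "x \<le> l"
    and bound: "\<And>s f. 0 \<le> s \<Longrightarrow> s \<le> x \<Longrightarrow> norm (tterm n s f) \<le> c * s ^ k / fact k * norm f"
    and "c \<ge> 0"
  shows "norm (tterm (Suc n) x f) \<le> ((norm q + norm p) * l * c) * x ^ Suc k / fact (Suc k) * norm f"
proof -
  define A where "A = (norm q + norm p) * l * c * norm f / fact k"
  have "norm (tsource n s (wave (x - s) f)) \<le> A * s ^ k" if s: "s \<in> {0..x}" for s
  proof -
    have w: "norm (wave (x - s) f) \<le> l * norm f"
      using norm_wave[of "x - s" f] mult_right_mono[of "x - s" l "norm f"] s x by (simp add: mult.commute)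
    have pw: "norm (bmult p (wave (x - s) f)) \<le> norm p * (l * norm f)"
      using norm_bmult[of p "wave (x - s) f"] mult_left_mono[OF w norm_ge_zero[of p]] by linarith
    have cs: "0 \<le> c * s ^ k / fact k" using s \<open>c \<ge> 0\<close> by simp
    have 1: "norm (tterm n s (wave (x - s) f)) \<le> c * s ^ k / fact k * (l * norm f)"
      using bound[of s "wave (x - s) f"] s mult_left_mono[OF w cs] by simp
    have 2: "norm (tterm n s (bmult p (wave (x - s) f))) \<le> c * s ^ k / fact k * (norm p * (l * norm f))"
      using bound[of s "bmult p (wave (x - s) f)"] s mult_left_mono[OF pw cs] by simp
    have "norm (tsource n s (wave (x - s) f)) \<le> norm (q s) * norm (tterm n s (wave (x - s) f)) + norm (tterm n s (bmult p (wave (x - s) f)))"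
      unfolding tsource_def by (metis norm_mult norm_triangle_ineq4)
    also have "\<dots> \<le> norm q * (c * s ^ k / fact k * (l * norm f)) + c * s ^ k / fact k * (norm p * (l * norm f))"
      by (intro add_mono mult_mono 1 2 norm_bounded) auto
    also have "\<dots> = A * s ^ k" by (simp add: A_def field_simps)
    finally show ?thesis .
  qed
  then have "norm (tterm (Suc n) x f) \<le> integral {0..x} (\<lambda>s. A * s ^ k)"
    unfolding tterm_Suc_upto[OF x]
    by (intro integral_norm_bound_integral integrable_continuous_real continuous_intros)
  also have "integral {0..x} (\<lambda>s. A * s ^ k) = A * (x ^ Suc k / Suc k)"
    using x by (simp add: integral_monomial)
  also have "\<dots> = ((norm q + norm p) * l * c) * x ^ Suc k / fact (Suc k) * norm f"
    by (simp add: A_def field_simps)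
  finally show ?thesis .
qed

lemma tterm_bound:
  assumes "0 \<le> x" "x \<le> l"
  shows "norm (tterm n x f) \<le> ((norm q + norm p) * l) ^ n * x ^ n / fact n * norm f"
  using assms
proof (induction n arbitrary: x f)
  case 0
  then show ?case by (simp add: norm_bounded)
next
  case (Suc n)
  then show ?case
    using tterm_bound_step[of x n "((norm q + norm p) * l) ^ n" n f]
    by simp
qed

text \<open>At \<open>n = 0\<close> the source collapses to
  \<open>(q r - p r) * wave (s - r) f r\<close>, which brings in the integral of
  \<open>norm (q s - p s)\<close>. Later steps carry this factor as a constant, so it is frozen at
  its value over \<open>{0..x}\<close> before the induction.\<close>

lemma tterm_Suc_bound:
  assumes "0 \<le> x" "x \<le> l"
  shows "norm (tterm (Suc n) x f) \<le>
    (((norm q + norm p) * l) ^ n * (l * integral {0..x} (\<lambda>s. norm (q s - p s)))) * x ^ n / fact n * norm f"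
proof -
  define b where "b = integral {0..x} (\<lambda>s. norm (q s - p s))"
  have c: "continuous_on S (\<lambda>s. norm (q s - p s))" for S by (intro continuous_intros)
  have b0: "0 \<le> b" unfolding b_def by (rule integral_nonneg[OF integrable_continuous_real[OF c]]) auto
  have "norm (tterm (Suc n) s f) \<le> (((norm q + norm p) * l) ^ n * (l * b)) * s ^ n / fact n * norm f"
    if "0 \<le> s" "s \<le> x" for s f
    using that
  proof (induction n arbitrary: s f)
    case 0
    have "norm (tterm (Suc 0) s f) \<le> integral {0..s} (\<lambda>r. norm (q r - p r) * (l * norm f))"
      unfolding tterm_Suc_upto[OF \<open>0 \<le> s\<close> order_trans[OF 0(2) assms(2)]]
    proof (intro integral_norm_bound_integral integrable_continuous_real continuous_intros)
      fix r assume r: "r \<in> {0..s}"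
      have w: "norm (wave (s - r) f) \<le> l * norm f"
        using norm_wave[of "s - r" f] mult_right_mono[of "s - r" l "norm f"] 0 r assms by (simp add: mult.commute)
      have "tsource 0 r (wave (s - r) f) = (q r - p r) * wave (s - r) f r"
        by (simp add: tsource_def algebra_simps)
      then show "norm (tsource 0 r (wave (s - r) f)) \<le> norm (q r - p r) * (l * norm f)"
        using mult_left_mono[OF order_trans[OF norm_bounded w], of "norm (q r - p r)" r]
        by (simp add: norm_mult)
    qed
    also have "\<dots> = integral {0..s} (\<lambda>r. norm (q r - p r)) * (l * norm f)" by simp
    also have "\<dots> \<le> b * (l * norm f)"
      unfolding b_def
      by (intro mult_right_mono integral_subset_le integrable_continuous_real c) (use 0 assms in auto)
    finally show ?case by (simp add: algebra_simps)
  next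
    case (Suc n)
    have "norm (tterm (Suc (Suc n)) s f) \<le> ((norm q + norm p) * l * (((norm q + norm p) * l) ^ n * (l * b))) * s ^ Suc n / fact (Suc n) * norm f"
      by (rule tterm_bound_step) (use Suc assms b0 in auto)
    then show ?case by (simp add: mult_ac)
  qed
  then show ?thesis using assms by (simp add: b_def)
qed

lemma bounded_linear_tterm: "0 \<le> x \<Longrightarrow> x \<le> l \<Longrightarrow> bounded_linear (tterm n x)"
  using tterm_bound[of x n]
  by (intro bounded_linear_intro[where K = "((norm q + norm p) * l) ^ n * x ^ n / fact n"])
     (auto simp: tterm_add tterm_scaleR mult.commute)

lemma bounded_linear_tsource: "0 \<le> x \<Longrightarrow> x \<le> l \<Longrightarrow> bounded_linear (tsource n x)"
  unfolding tsource_def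
  by (intro bounded_linear_sub bounded_linear_const_mult bounded_linear_tterm
      bounded_linear_compose[OF bounded_linear_tterm bounded_linear_bmult])

lemma tsource_local:
  fixes f g :: "real \<Rightarrow>\<^sub>C complex"
  assumes "0 \<le> x" "\<And>y. \<bar>y\<bar> \<le> x \<Longrightarrow> g y = f y"
  shows "tsource n x g = tsource n x f"
  using tterm_local[of x g 1 f n] tterm_local[of x "bmult p g" 1 "bmult p f" n] assms
  by (simp add: tsource_def)

end

text \<open>Taylor's formula in the time variable, started at \<open>t = s\<close>: the d'Alembert
  solution \<open>G\<close> has \<open>G s = 0\<close>, first derivative \<open>f z\<close> there,
  and second derivative \<open>wave (t - s) m z\<close>. The \<open>max\<close> and the vanishing of
  waves before time 0 cover the case \<open>x \<le> s\<close> too.\<close>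

lemma wave_taylor:
  fixes f m :: "real \<Rightarrow>\<^sub>C complex"
  assumes f: "\<And>y. \<bar>y\<bar> \<le> r \<Longrightarrow> f y = f 0 + prim (prim m) y"
    and "0 \<le> x" "x \<le> r" "\<bar>z\<bar> \<le> s"
  shows "wave (x - s) f z = max (x - s) 0 *\<^sub>R f z + integral {0..x} (\<lambda>t. (x - t) *\<^sub>R wave (t - s) m z)"
proof (cases "x \<le> s")
  case True
  then have "integral {0..x} (\<lambda>t. (x - t) *\<^sub>R wave (t - s) m z) = integral {0..x} (\<lambda>t. 0)"
    by (intro integral_cong) auto
  then show ?thesis using True by simp
next
  case False
  have "0 \<le> s" using assms(4) by linarith
  \<comment> \<open>The hypothesis describes \<open>f\<close> only on \<open>{-r..r}\<close>.
    \<open>F\<close> has this form on the whole line, so its derivatives exist everywhere, and it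
    agrees with \<open>f\<close> wherever the wave at \<open>z\<close> looks.\<close>
  define F where "F = (\<lambda>y. f 0 + prim (prim m) y)"
  have fF: "f y = F y" if "\<bar>y\<bar> \<le> r" for y
    unfolding F_def by (rule f[OF that])
  define G where "G = (\<lambda>t. (prim F (z + t - s) - prim F (z - t + s)) / 2)"
  define G1 where "G1 = (\<lambda>t. (F (z + t - s) + F (z - t + s)) / 2)"
  define G2 where "G2 = (\<lambda>t. (prim m (z + t - s) - prim m (z - t + s)) / 2)"
  have cF: "continuous_on UNIV F"
    unfolding F_def by (intro continuous_intros prim_continuous)
  have dF: "(F has_vector_derivative prim m y) (at y within S)" for y S
    unfolding F_def using prim_has_derivative[of "prim m" y S]
    by (auto intro!: derivative_eq_intros prim_continuous)
  have d1: "((\<lambda>t. z + t - s) has_vector_derivative 1) (at t within S)" for t S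
    by (auto intro!: derivative_eq_intros)
  have d2: "((\<lambda>t. z - t + s) has_vector_derivative -1) (at t within S)" for t S
    by (auto intro!: derivative_eq_intros)
  note chain1 = vector_diff_chain_within[OF d1, unfolded o_def]
    and chain2 = vector_diff_chain_within[OF d2, unfolded o_def]
  have dG: "(G has_vector_derivative G1 t) (at t within S)" for t S
    unfolding G_def G1_def
    by (rule has_vector_derivative_eq_rhs, rule has_vector_derivative_divide,
        rule has_vector_derivative_diff[OF chain1[OF prim_has_derivative[OF cF]] chain2[OF prim_has_derivative[OF cF]]]) simp
  have dG1: "(G1 has_vector_derivative G2 t) (at t within S)" for t S
    unfolding G1_def G2_def
    by (rule has_vector_derivative_eq_rhs, rule has_vector_derivative_divide,
        rule has_vector_derivative_add[OF chain1[OF dF] chain2[OF dF]]) simp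
  have "((\<lambda>t. (x - t) *\<^sub>R G2 t) has_integral
      ((x - x) *\<^sub>R G1 x + G x - ((x - s) *\<^sub>R G1 s + G s))) {s..x}"
    using False
    by (intro fundamental_theorem_of_calculus)
       (auto intro!: derivative_eq_intros dG dG1)
  then have I: "integral {s..x} (\<lambda>t. (x - t) *\<^sub>R G2 t) = G x - (x - s) *\<^sub>R F z"
    by (simp add: integral_unique G_def G1_def)
  have "integral {z - (x - s)..z + (x - s)} f = integral {z - (x - s)..z + (x - s)} F"
    by (rule integral_cong) (rule fF, use assms(2-4) in auto)
  then have "prim f (z + (x - s)) - prim f (z - (x - s)) = prim F (z + (x - s)) - prim F (z - (x - s))"
    using False by (simp add: prim_diff cF)
  moreover have "wave (x - s) f z = (prim f (z + (x - s)) - prim f (z - (x - s))) / 2"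
    using False by (simp add: wave_apply)
  moreover have "G x = (prim F (z + (x - s)) - prim F (z - (x - s))) / 2"
    by (simp add: G_def algebra_simps)
  ultimately have w: "wave (x - s) f z = G x"
    by (simp only:)
  have wm: "wave (t - s) m z = G2 t" if "t \<in> {s..x}" for t
    using that by (simp add: wave_apply G2_def algebra_simps)
  have "integral {0..s} (\<lambda>t. (x - t) *\<^sub>R wave (t - s) m z) + integral {s..x} (\<lambda>t. (x - t) *\<^sub>R wave (t - s) m z)
      = integral {0..x} (\<lambda>t. (x - t) *\<^sub>R wave (t - s) m z)"
    using False \<open>0 \<le> s\<close>
    by (intro Henstock_Kurzweil_Integration.integral_combine integrable_continuous_real continuous_intros
         bounded_linear.continuous_on[OF bounded_linear_bcontfun_eval]) auto
  moreover have "integral {0..s} (\<lambda>t. (x - t) *\<^sub>R wave (t - s) m z) = integral {0..s} (\<lambda>t. 0)"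
    by (intro integral_cong) auto
  moreover have "integral {s..x} (\<lambda>t. (x - t) *\<^sub>R wave (t - s) m z) = integral {s..x} (\<lambda>t. (x - t) *\<^sub>R G2 t)"
    by (intro integral_cong) (simp add: wm)
  moreover have "F z = f z" using fF[of z] assms(2-4) False by simp
  ultimately show ?thesis using I w False by (simp add: max_def diff_eq_eq add.commute)
qed

text \<open>The equation \<open>(tterm (Suc n) f)'' = tterm (Suc n) m + tsource n f\<close> with
  zero Cauchy data, integrated twice. Inserting \<open>wave_taylor\<close> into Duhamel's integral
  gives the source from the \<open>max\<close> part; the remainder, after exchanging the integrals,
  is again a term of index \<open>Suc n\<close>, now applied to \<open>m\<close>.\<close>

lemma tterm_Suc_eq:
  fixes f m :: "real \<Rightarrow>\<^sub>C complex"
  assumes f: "\<And>y. \<bar>y\<bar> \<le> l \<Longrightarrow> f y = f 0 + prim (prim m) y"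
    and x: "0 \<le> x" "x \<le> l"
  shows "tterm l p q (Suc n) x f =
    integral {0..x} (\<lambda>s. (x - s) *\<^sub>R (tterm l p q (Suc n) s m + tsource l p q n s f))"
proof -
  let ?R = "tsource l p q n"
  have eq: "?R s (wave (x - s) f) = max (x - s) 0 *\<^sub>R ?R s f + integral {0..x} (\<lambda>t. (x - t) *\<^sub>R ?R s (wave (t - s) m))"
    if s: "s \<in> {0..l}" for s
  proof -
    define g where "g = integral {0..x} (\<lambda>t. (x - t) *\<^sub>R wave (t - s) m)"
    have i: "(\<lambda>t. (x - t) *\<^sub>R wave (t - s) m) integrable_on {0..x}"
      by (intro integrable_continuous_real continuous_intros)
    note lin = bounded_linear_tsource[of s l p q n]
    have "g y = integral {0..x} (\<lambda>t. (x - t) *\<^sub>R wave (t - s) m y)" for y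
      using integral_linear[OF i bounded_linear_bcontfun_eval[of y]] by (simp add: g_def o_def)
    \<comment> \<open>The Taylor formula holds only at points with
      \<open>\<bar>y\<bar> \<le> s\<close>; locality of the source at \<open>s\<close> makes this
      enough.\<close>
    then have "?R s (wave (x - s) f) = ?R s (max (x - s) 0 *\<^sub>R f + g)"
      using wave_taylor[OF f x] s by (intro tsource_local) auto
    also have "\<dots> = max (x - s) 0 *\<^sub>R ?R s f + ?R s g"
      using lin s by (simp add: linear_add linear_scale bounded_linear.linear)
    also have "?R s g = integral {0..x} (\<lambda>t. ?R s ((x - t) *\<^sub>R wave (t - s) m))"
      using integral_linear[OF i lin] s by (simp add: g_def o_def)
    also have "(\<lambda>t. ?R s ((x - t) *\<^sub>R wave (t - s) m)) = (\<lambda>t. (x - t) *\<^sub>R ?R s (wave (t - s) m))"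
      using lin s by (simp add: linear_scale bounded_linear.linear)
    finally show ?thesis .
  qed
  have "tterm l p q (Suc n) x f =
     integral {0..l} (\<lambda>s. max (x - s) 0 *\<^sub>R ?R s f + integral {0..x} (\<lambda>t. (x - t) *\<^sub>R ?R s (wave (t - s) m)))"
    unfolding tterm_Suc by (rule integral_cong) (rule eq)
  also have "\<dots> = integral {0..l} (\<lambda>s. max (x - s) 0 *\<^sub>R ?R s f)
      + integral {0..l} (\<lambda>s. integral {0..x} (\<lambda>t. (x - t) *\<^sub>R ?R s (wave (t - s) m)))"
  proof (rule Henstock_Kurzweil_Integration.integral_add; rule integrable_continuous_real)
    show "continuous_on {0..l} (\<lambda>s. max (x - s) 0 *\<^sub>R ?R s f)"
      by (intro continuous_intros)
    have "continuous_on {0..l} (\<lambda>s. integral (cbox 0 x) (\<lambda>t. (x - t) *\<^sub>R ?R s (wave (t - s) m)))"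
      by (rule integral_continuous_on_param) (auto simp: case_prod_unfold intro!: continuous_intros)
    then show "continuous_on {0..l} (\<lambda>s. integral {0..x} (\<lambda>t. (x - t) *\<^sub>R ?R s (wave (t - s) m)))"
      by simp
  qed
  also have "integral {0..l} (\<lambda>s. integral {0..x} (\<lambda>t. (x - t) *\<^sub>R ?R s (wave (t - s) m)))
     = integral {0..x} (\<lambda>t. integral {0..l} (\<lambda>s. (x - t) *\<^sub>R ?R s (wave (t - s) m)))"
    using integral_swap_continuous[of 0 0 l x "\<lambda>s t. (x - t) *\<^sub>R ?R s (wave (t - s) m)"]
    by (simp add: case_prod_unfold continuous_intros)
  also have "(\<lambda>t. integral {0..l} (\<lambda>s. (x - t) *\<^sub>R ?R s (wave (t - s) m))) = (\<lambda>t. (x - t) *\<^sub>R tterm l p q (Suc n) t m)"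
    by (simp add: tterm_Suc)
  also have "integral {0..l} (\<lambda>s. max (x - s) 0 *\<^sub>R ?R s f) = integral {0..x} (\<lambda>s. (x - s) *\<^sub>R ?R s f)"
  proof -
    have "integral {0..x} (\<lambda>s. max (x - s) 0 *\<^sub>R ?R s f) + integral {x..l} (\<lambda>s. max (x - s) 0 *\<^sub>R ?R s f)
       = integral {0..l} (\<lambda>s. max (x - s) 0 *\<^sub>R ?R s f)"
      using x by (intro Henstock_Kurzweil_Integration.integral_combine integrable_continuous_real continuous_intros)
    moreover have "integral {x..l} (\<lambda>s. max (x - s) 0 *\<^sub>R ?R s f) = integral {x..l} (\<lambda>s. 0)"
      by (rule integral_cong) auto
    moreover have "integral {0..x} (\<lambda>s. max (x - s) 0 *\<^sub>R ?R s f) = integral {0..x} (\<lambda>s. (x - s) *\<^sub>R ?R s f)"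
      by (rule integral_cong) auto
    ultimately show ?thesis by simp
  qed
  also have "integral {0..x} (\<lambda>s. (x - s) *\<^sub>R ?R s f) + integral {0..x} (\<lambda>t. (x - t) *\<^sub>R tterm l p q (Suc n) t m)
     = integral {0..x} (\<lambda>s. (x - s) *\<^sub>R ?R s f + (x - s) *\<^sub>R tterm l p q (Suc n) s m)"
    by (rule Henstock_Kurzweil_Integration.integral_add[symmetric]; intro integrable_continuous_real continuous_intros)
  finally show ?thesis by (simp add: algebra_simps)
qed

section \<open>The sum of the Neumann series\<close>

definition transf :: "real \<Rightarrow> (real \<Rightarrow>\<^sub>C complex) \<Rightarrow> (real \<Rightarrow>\<^sub>C complex) \<Rightarrow> real \<Rightarrow> (real \<Rightarrow>\<^sub>C complex) \<Rightarrow> complex" where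
  "transf l p q x f = (\<Sum>n. tterm l p q n x f)"

context
  fixes l :: real and p q :: "real \<Rightarrow>\<^sub>C complex" and B :: "nat \<Rightarrow> real"
  defines "B \<equiv> \<lambda>n. ((norm q + norm p) * l * l) ^ n / fact n"
begin

lemma summable_B: "summable B" and suminf_B: "suminf B = exp ((norm q + norm p) * l * l)"
proof -
  have "B = (\<lambda>n. ((norm q + norm p) * l * l) ^ n /\<^sub>R fact n)"
    by (simp add: B_def fun_eq_iff divide_inverse mult.commute)
  then show "summable B" "suminf B = exp ((norm q + norm p) * l * l)"
    using summable_exp_generic[of "(norm q + norm p) * l * l"] by (simp_all only: exp_def)
qed

lemma tterm_bound_B:
  assumes "0 \<le> x" "x \<le> l"
  shows "norm (tterm l p q n x f) \<le> B n * norm f"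
proof -
  have "((norm q + norm p) * l) ^ n * x ^ n / fact n \<le> B n"
    using assms unfolding B_def power_mult_distrib
    by (intro divide_right_mono mult_left_mono power_mono mult_nonneg_nonneg zero_le_power) auto
  then show ?thesis
    using tterm_bound[OF assms, of p q n f] mult_right_mono[OF _ norm_ge_zero[of f]] by (metis order_trans)
qed

lemma tterm_sums: "0 \<le> x \<Longrightarrow> x \<le> l \<Longrightarrow> (\<lambda>n. tterm l p q n x f) sums transf l p q x f"
  unfolding transf_def
  by (rule summable_sums, rule summable_comparison_test'[OF summable_mult2[OF summable_B]])
     (rule tterm_bound_B)

lemma bounded_linear_transf:
  assumes x: "0 \<le> x" "x \<le> l"
  shows "bounded_linear (transf l p q x)"
proof (rule bounded_linear_intro[where K = "suminf B"])
  fix f g :: "real \<Rightarrow>\<^sub>C complex" and r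
  note s = tterm_sums[OF x]
  show "transf l p q x (f + g) = transf l p q x f + transf l p q x g"
    using sums_unique2[OF s[of "f + g"]] sums_add[OF s[of f] s[of g]] by (simp add: tterm_add)
  show "transf l p q x (r *\<^sub>R f) = r *\<^sub>R transf l p q x f"
    using sums_unique2[OF s[of "r *\<^sub>R f"]] sums_scaleR_right[OF s[of f]] x by (simp add: tterm_scaleR)
  have "norm (\<Sum>n. tterm l p q n x f) \<le> (\<Sum>n. B n * norm f)"
    by (rule norm_suminf_le[OF tterm_bound_B[OF x] summable_mult2[OF summable_B]])
  then show "norm (transf l p q x f) \<le> norm f * suminf B"
    using suminf_mult2[OF summable_B, of "norm f"] by (simp add: transf_def mult.commute)
qed

lemma transf_local:
  fixes f g :: "real \<Rightarrow>\<^sub>C complex"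
  assumes "0 \<le> x" "x \<le> l" "\<And>y. \<bar>y\<bar> \<le> x \<Longrightarrow> g y = c * f y"
  shows "transf l p q x g = c * transf l p q x f"
  using sums_unique2[OF tterm_sums[of x g]] sums_mult[OF tterm_sums[of x f], of c]
  by (simp add: assms tterm_local[OF assms(1,3)])

lemma continuous_on_transf_fixed: "continuous_on {0..l} (\<lambda>x. transf l p q x f)"
proof -
  have "uniform_limit {0..l} (\<lambda>n x. \<Sum>i<n. tterm l p q i x f) (\<lambda>x. suminf (\<lambda>i. tterm l p q i x f)) sequentially"
    by (rule Weierstrass_m_test[OF _ summable_mult2[OF summable_B]]) (auto intro: tterm_bound_B)
  then show ?thesis
    unfolding transf_def
    by (rule uniform_limit_theorem[rotated]) (auto intro!: always_eventually continuous_intros)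
qed

lemma continuous_on_transf: "continuous_on ({0..l} \<times> UNIV) (\<lambda>(x, f). transf l p q x f)"
proof -
  have "((\<lambda>z. transf l p q (fst z) (snd z)) \<longlongrightarrow> transf l p q x f) (at (x, f) within {0..l} \<times> UNIV)"
    if x: "x \<in> {0..l}" for x f
  proof (rule Lim_transform2)
    have "continuous_on ({0..l} \<times> UNIV) (\<lambda>z. transf l p q (fst z) f)"
      by (rule continuous_on_compose2[OF continuous_on_transf_fixed]) (auto intro!: continuous_intros)
    then show "((\<lambda>z. transf l p q (fst z) f) \<longlongrightarrow> transf l p q x f) (at (x, f) within {0..l} \<times> UNIV)"
      using x by (auto simp: continuous_on_def)
    show "((\<lambda>z. transf l p q (fst z) f - transf l p q (fst z) (snd z)) \<longlongrightarrow> 0) (at (x, f) within {0..l} \<times> UNIV)"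
    proof (rule Lim_null_comparison)
      show "((\<lambda>z. suminf B * norm (f - snd z)) \<longlongrightarrow> 0) (at (x, f) within {0..l} \<times> UNIV)"
        by (rule tendsto_eq_intros | simp)+
      show "\<forall>\<^sub>F z in at (x, f) within {0..l} \<times> UNIV.
         norm (transf l p q (fst z) f - transf l p q (fst z) (snd z)) \<le> suminf B * norm (f - snd z)"
        unfolding eventually_at_filter
      proof (intro always_eventually allI impI)
        fix z :: "real \<times> (real \<Rightarrow>\<^sub>C complex)" assume z: "z \<in> {0..l} \<times> UNIV"
        have "norm (\<Sum>n. tterm l p q n (fst z) (f - snd z)) \<le> (\<Sum>n. B n * norm (f - snd z))"
          by (rule norm_suminf_le[OF tterm_bound_B summable_mult2[OF summable_B]]) (use z in auto)
        moreover have "transf l p q (fst z) f - transf l p q (fst z) (snd z) = transf l p q (fst z) (f - snd z)"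
          using bounded_linear_transf[of "fst z"] z by (auto simp: bounded_linear.linear linear_diff)
        ultimately show "norm (transf l p q (fst z) f - transf l p q (fst z) (snd z)) \<le> suminf B * norm (f - snd z)"
          using suminf_mult2[OF summable_B, of "norm (f - snd z)"] by (simp add: transf_def)
      qed
    qed
  qed
  then show ?thesis
    by (auto simp: continuous_on_def case_prod_unfold)
qed

lemma transf_diff_bound:
  assumes x: "0 \<le> x" "x \<le> l"
  shows "norm (transf l p q x f - f x) \<le>
    l * exp ((norm q + norm p) * l * l) * norm f * integral {0..x} (\<lambda>s. norm (q s - p s))"
proof -
  define b where "b = integral {0..x} (\<lambda>s. norm (q s - p s))"
  have b: "0 \<le> b"
    unfolding b_def by (intro integral_nonneg integrable_continuous_real continuous_intros) auto
  have s: "(\<lambda>n. tterm l p q (Suc n) x f) sums (transf l p q x f - f x)"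
    using tterm_sums[OF x, of f] by (simp add: sums_Suc_iff[of "\<lambda>n. tterm l p q n x f"])
  have "norm (tterm l p q (Suc n) x f) \<le> B n * (l * b * norm f)" for n
  proof -
    have "norm (tterm l p q (Suc n) x f) \<le> (((norm q + norm p) * l) ^ n * x ^ n / fact n) * (l * b * norm f)"
      using tterm_Suc_bound[OF x, of p q n f] by (simp add: b_def mult_ac)
    also have "\<dots> \<le> B n * (l * b * norm f)"
      using x b unfolding B_def power_mult_distrib
      by (intro mult_right_mono divide_right_mono mult_left_mono power_mono mult_nonneg_nonneg zero_le_power) auto
    finally show ?thesis .
  qed
  from norm_suminf_le[OF this summable_mult2[OF summable_B]] show ?thesis
    using suminf_mult2[OF summable_B, of "l * b * norm f"] sums_unique[OF s] suminf_B
    by (simp add: b_def mult_ac)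
qed

text \<open>The intertwining relation \<open>(S f)'' = q * S f + S (f'' - p * f)\<close> with
  \<open>S f 0 = f 0\<close> and \<open>(S f)' 0 = 0\<close>, integrated twice; the hypothesis on
  \<open>f\<close> encodes \<open>f'' = m\<close> and \<open>f' 0 = 0\<close>. It is the sum over
  \<open>n\<close> of \<open>tterm_Suc_eq\<close>.\<close>

lemma transf_eq:
  fixes f m :: "real \<Rightarrow>\<^sub>C complex"
  assumes f: "\<And>y. \<bar>y\<bar> \<le> l \<Longrightarrow> f y = f 0 + prim (prim m) y"
    and x: "0 \<le> x" "x \<le> l"
  shows "transf l p q x f =
    f 0 + integral {0..x} (\<lambda>s. (x - s) *\<^sub>R (q s * transf l p q s f + transf l p q s (m - bmult p f)))"
proof -
  define k where "k = (\<lambda>n s. (x - s) *\<^sub>R (tterm l p q (Suc n) s m + tsource l p q n s f))"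
  have bound: "norm (k n s) \<le> l * (B (Suc n) * norm m + B n * (norm q * norm f + norm p * norm f))"
    if s: "s \<in> {0..x}" for n s
  proof -
    have s': "0 \<le> s" "s \<le> l" using s x by auto
    have B0: "0 \<le> B n" for n using x by (simp add: B_def)
    have "norm (tsource l p q n s f) \<le> norm (q s) * norm (tterm l p q n s f) + norm (tterm l p q n s (bmult p f))"
      unfolding tsource_def by (metis norm_mult norm_triangle_ineq4)
    also have "\<dots> \<le> norm q * (B n * norm f) + B n * (norm p * norm f)"
      using tterm_bound_B[OF s', of n "bmult p f"] mult_left_mono[OF norm_bmult[of p f] B0[of n]]
      by (intro add_mono mult_mono tterm_bound_B[OF s'] norm_bounded) auto
    finally have "norm (tsource l p q n s f) \<le> norm q * (B n * norm f) + B n * (norm p * norm f)" .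
    from norm_triangle_mono[OF tterm_bound_B[OF s', of "Suc n" m] this]
    have "norm (tterm l p q (Suc n) s m + tsource l p q n s f)
       \<le> B (Suc n) * norm m + B n * (norm q * norm f + norm p * norm f)"
      by (simp add: algebra_simps)
    then show ?thesis
      using s x by (auto simp: k_def intro!: mult_mono)
  qed
  have "summable (\<lambda>n. l * (B (Suc n) * norm m + B n * (norm q * norm f + norm p * norm f)))"
    by (intro summable_mult summable_add summable_mult2 summable_B)
       (use summable_B summable_Suc_iff in blast)
  \<comment> \<open>Uniform convergence on \<open>{0..x}\<close> permits exchanging the sum with the
    integral.\<close>
  from Weierstrass_m_test[OF bound this]
  have lim: "uniform_limit {0..x} (\<lambda>n s. \<Sum>i<n. k i s) (\<lambda>s. \<Sum>i. k i s) sequentially" .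
  have ck: "continuous_on {0..x} (k n)" for n
    unfolding k_def by (intro continuous_intros)
  obtain I J where I: "\<And>n. ((\<lambda>s. \<Sum>i<n. k i s) has_integral I n) {0..x}"
    and J: "((\<lambda>s. \<Sum>i. k i s) has_integral J) {0..x}" and IJ: "I \<longlonglongrightarrow> J"
    by (rule uniform_limit_integral[OF lim]) (auto intro!: continuous_intros ck)
  have "I n = (\<Sum>i<n. tterm l p q (Suc i) x f)" for n
    using has_integral_unique[OF I[of n] has_integral_sum[OF _ integrable_integral[OF integrable_continuous_real[OF ck]]]]
    by (simp add: tterm_Suc_eq[OF f x] k_def)
  then have "I = (\<lambda>n. \<Sum>i<n. tterm l p q (Suc i) x f)" by (rule ext)
  then have "(\<lambda>n. tterm l p q (Suc n) x f) sums J"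
    using IJ by (simp add: sums_def)
  moreover have "(\<lambda>n. tterm l p q (Suc n) x f) sums (transf l p q x f - f x)"
    using tterm_sums[OF x, of f] by (simp add: sums_Suc_iff[of "\<lambda>n. tterm l p q n x f"])
  ultimately have J': "J = transf l p q x f - f x" by (rule sums_unique2)
  have "(\<Sum>i. k i s) = (x - s) *\<^sub>R (q s * transf l p q s f + transf l p q s (m - bmult p f)) - (x - s) *\<^sub>R m s"
    if s: "s \<in> {0..x}" for s
  proof -
    have s': "0 \<le> s" "s \<le> l" using s x by auto
    have "(\<lambda>i. k i s) sums ((x - s) *\<^sub>R ((transf l p q s m - m s) + (q s * transf l p q s f - transf l p q s (bmult p f))))"
      unfolding k_def tsource_def
      using tterm_sums[OF s', of m]
      by (intro sums_scaleR_right sums_add sums_diff sums_mult tterm_sums s') (simp add: sums_Suc_iff[of "\<lambda>n. tterm l p q n s m"])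
    moreover have "transf l p q s (m - bmult p f) = transf l p q s m - transf l p q s (bmult p f)"
      using bounded_linear_transf[OF s'] by (simp add: linear_diff bounded_linear.linear)
    then have "(transf l p q s m - m s) + (q s * transf l p q s f - transf l p q s (bmult p f))
      = (q s * transf l p q s f + transf l p q s (m - bmult p f)) - m s"
      by simp
    ultimately show ?thesis
      by (simp only: sums_unique[symmetric] scaleR_diff_right)
  qed
  with J have 1: "((\<lambda>s. (x - s) *\<^sub>R (q s * transf l p q s f + transf l p q s (m - bmult p f)) - (x - s) *\<^sub>R m s)
      has_integral J) {0..x}"
    by (rule has_integral_eq[rotated])
  \<comment> \<open>The shifted series starts at index 1 and so lacks \<open>m s\<close> in the
    integrand and \<open>f x\<close> on the left; the two gaps differ by exactly
    \<open>f 0\<close>.\<close>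
  have 2: "((\<lambda>s. (x - s) *\<^sub>R m s) has_integral prim (prim m) x) {0..x}"
    unfolding prim_taylor[OF continuous_on_apply_bcontfun x(1)]
    by (intro integrable_integral integrable_continuous_real continuous_intros)
  have "((\<lambda>s. (x - s) *\<^sub>R (q s * transf l p q s f + transf l p q s (m - bmult p f)))
      has_integral J + prim (prim m) x) {0..x}"
    using has_integral_add[OF 1 2] by (simp only: diff_add_cancel)
  then show ?thesis
    using f[of x] x J' by (simp add: integral_unique)
qed

end

subsection \<open>Uniqueness for the lateral Cauchy problem\<close>

lemma gronwall:
  fixes A :: "real \<Rightarrow> real"
  assumes "0 \<le> x" "0 \<le> c" and cont: "continuous_on {0..x} A"
    and le: "\<And>y. 0 \<le> y \<Longrightarrow> y \<le> x \<Longrightarrow> A y \<le> G + c * integral {0..y} A"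
  shows "A x \<le> G * exp (c * x)"
proof -
  define R where "R = (\<lambda>y. (G + c * integral {0..y} A) * exp (- (c * y)))"
  have d: "((\<lambda>u. integral {0..u} A) has_real_derivative A y) (at y within {0..x})" if "y \<in> {0..x}" for y
    using integral_has_real_derivative[OF cont that] .
  have "R x \<le> R 0"
  proof (rule DERIV_nonpos_imp_decreasing_open[OF \<open>0 \<le> x\<close>])
    show "continuous_on {0..x} R"
      unfolding R_def
      by (intro continuous_intros indefinite_integral_continuous_1 integrable_continuous_real cont)
    fix y assume y: "0 < y" "y < x"
    have "((\<lambda>u. integral {0..u} A) has_real_derivative A y) (at y)"
      using d[of y] y by (simp add: at_within_Icc_at)
    then have "(R has_real_derivative (c * A y - c * (G + c * integral {0..y} A)) * exp (- (c * y))) (at y)"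
      unfolding R_def by (auto intro!: derivative_eq_intros simp: algebra_simps)
    moreover have "(c * A y - c * (G + c * integral {0..y} A)) * exp (- (c * y)) \<le> 0"
      using mult_left_mono[OF le[of y] \<open>0 \<le> c\<close>] y by (intro mult_nonpos_nonneg) auto
    ultimately show "\<exists>D. (R has_real_derivative D) (at y) \<and> D \<le> 0" by blast
  qed
  then have "G + c * integral {0..x} A \<le> G * exp (c * x)"
    by (simp add: R_def exp_minus field_simps)
  then show ?thesis using le[of x] assms(1) by simp
qed

text \<open>\<open>fact (n + k) / fact n\<close> is a product of \<open>k\<close> factors, each at
  least \<open>n\<close>. With \<open>k = n\<close> this lets \<open>fact (2 * n)\<close> absorb the
  growth \<open>n ^ n\<close> and still leave \<open>fact n\<close>.\<close>

lemma power_mult_fact_le: "real n ^ k * fact n \<le> fact (n + k)"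
proof (induction k)
  case (Suc k)
  have "real n ^ Suc k * fact n = real n * (real n ^ k * fact n)" by simp
  also have "\<dots> \<le> real (n + Suc k) * fact (n + k)"
    by (intro mult_mono Suc) auto
  finally show ?case by simp
qed auto

text \<open>
  Test \<open>v\<close> with \<open>(d - t)\<^sup>n t\<^sup>n\<close> on \<open>{0..d}\<close>. Integrating by parts in time \<open>n\<close> times costs a factor of
  order \<open>n\<^sup>n\<close>, while integrating the equation in space gains \<open>x\<^sup>2\<^sup>n / (2 n)!\<close>. So the moment is bounded by
  \<open>C\<^sup>n / n!\<close>, whereas it is at least a multiple of \<open>(d / 3)\<^sup>2\<^sup>n\<close> if \<open>v\<close> stays away from \<open>0\<close> on \<open>{0..d}\<close>.
\<close>

lemma cauchy_uniqueness:
  fixes v z :: "real \<Rightarrow> real \<Rightarrow> complex" and Q :: "real \<Rightarrow> complex"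
  assumes "0 < T" "0 \<le> l"
    and cv: "continuous_on ({0..T} \<times> {0..l}) (\<lambda>(t, x). v t x)"
    and cz: "continuous_on ({0..T} \<times> {0..l}) (\<lambda>(t, x). z t x)"
    and cQ: "continuous_on {0..l} Q"
    and dt: "\<And>t x. t \<in> {0..T} \<Longrightarrow> x \<in> {0..l} \<Longrightarrow> ((\<lambda>t. v t x) has_vector_derivative z t x) (at t within {0..T})"
    and eq: "\<And>t x. t \<in> {0..T} \<Longrightarrow> x \<in> {0..l} \<Longrightarrow>
        v t x = integral {0..x} (\<lambda>y. (x - y) *\<^sub>R (Q y * v t y + \<i> * z t y))"
    and x0: "x0 \<in> {0..l}"
  shows "v 0 x0 = 0"
proof (rule ccontr)
  assume nz: "v 0 x0 \<noteq> 0"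
  \<comment> \<open>With half the norm, replacing \<open>v t x0\<close> by \<open>v 0 x0\<close> in
    a moment loses at most half of the main term, and \<open>e\<close> times the mass of the weight
    survives.\<close>
  define e where "e = norm (v 0 x0) / 2"
  have e: "e > 0" using nz by (simp add: e_def)
  note [continuous_intros] = continuous_on_compose2[OF cv, where f = "\<lambda>z. (a z, b z)" for a b, simplified]
    continuous_on_compose2[OF cz, where f = "\<lambda>z. (a z, b z)" for a b, simplified]
    continuous_on_compose2[OF cQ]
  have "continuous_on {0..T} (\<lambda>t. v t x0)"
    using x0 by (auto intro!: continuous_intros)
  then obtain d0 where d0: "d0 > 0" "\<And>t. t \<in> {0..T} \<Longrightarrow> \<bar>t\<bar> < d0 \<Longrightarrow> norm (v t x0 - v 0 x0) \<le> e"
    using e \<open>0 < T\<close> unfolding continuous_on_iff dist_norm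
    by (metis atLeastAtMost_iff diff_zero less_eq_real_def real_norm_def order_refl)
  \<comment> \<open>\<open>d \<le> 1\<close> keeps all weights below 1, so that one bound
    \<open>A\<close> serves every moment; halving \<open>d0\<close> gives the strict inequality
    needed for \<open>d0\<close>.\<close>
  define d where "d = min (d0 / 2) (min 1 T)"
  have d: "0 < d" "d \<le> 1" "d \<le> T" "d < d0"
    using d0(1) \<open>0 < T\<close> by (auto simp: d_def)
  have "compact ((\<lambda>(t, x). v t x) ` ({0..T} \<times> {0..l}))"
    by (intro compact_continuous_image cv compact_Times) auto
  from compact_imp_bounded[OF this] obtain A where A': "\<forall>w \<in> (\<lambda>(t, x). v t x) ` ({0..T} \<times> {0..l}). norm w \<le> A"
    unfolding bounded_iff ..
  have A: "norm (v t x) \<le> A" if "t \<in> {0..T}" "x \<in> {0..l}" for t x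
    using A'[THEN bspec, OF imageI, of "(t, x)"] that by simp
  have A0: "0 \<le> A"
    using order_trans[OF norm_ge_zero A[of 0 0]] \<open>0 < T\<close> \<open>0 \<le> l\<close> by simp
  have "compact (Q ` {0..l})" by (intro compact_continuous_image cQ) auto
  from compact_imp_bounded[OF this] obtain M where M': "\<forall>w \<in> Q ` {0..l}. norm w \<le> M"
    unfolding bounded_iff ..
  have M: "norm (Q x) \<le> M" if "x \<in> {0..l}" for x
    using M' that by blast
  have M0: "0 \<le> M"
    using order_trans[OF norm_ge_zero M[of 0]] \<open>0 \<le> l\<close> by simp
  \<comment> \<open>Differentiation lowers either exponent, so the two must vary independently even
    though only \<open>m = k\<close> matters in the end. If both are positive, the weight vanishes
    at \<open>0\<close> and \<open>d\<close> and leaves no boundary terms.\<close>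
  define g where "g = (\<lambda>m k t. (d - t) ^ m * t ^ k :: real)"
  have g: "0 \<le> g m k t" "g m k t \<le> 1" if "t \<in> {0..d}" for m k t
    using that d by (auto simp: g_def intro!: mult_le_one power_le_one)
  have cg: "continuous_on S (g m k)" for S m k unfolding g_def by (intro continuous_intros)
  have sub: "{0..d} \<subseteq> {0..T}" using d by auto
  define F where "F = (\<lambda>m k x. integral {0..d} (\<lambda>t. g m k t *\<^sub>R v t x))"
  have cF: "continuous_on {0..l} (F m k)" for m k
  proof -
    have "continuous_on {0..l} (\<lambda>x. integral (cbox 0 d) (\<lambda>t. g m k t *\<^sub>R v t x))"
      by (rule integral_continuous_on_param)
         (use sub in \<open>auto simp: case_prod_unfold g_def intro!: continuous_intros\<close>)
    then show ?thesis by (simp add: F_def)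
  qed
  have F_bound: "norm (F m k x) \<le> A" if x: "x \<in> {0..l}" for m k x
  proof -
    have "norm (F m k x) \<le> A * (d - 0)"
      unfolding F_def
    proof (rule integral_bound)
      show "continuous_on {0..d} (\<lambda>t. g m k t *\<^sub>R v t x)"
        using x sub by (auto intro!: continuous_intros cg)
      show "norm (g m k t *\<^sub>R v t x) \<le> A" if "t \<in> {0..d}" for t
        using mult_mono[OF g(2)[OF that, of m k] A[of t x]] g(1)[OF that, of m k] that sub x by auto
    qed (use d in auto)
    also have "\<dots> \<le> A" using d A0 by (simp add: mult_left_le)
    finally show ?thesis .
  qed
  have parts: "integral {0..d} (\<lambda>t. g (Suc m) (Suc k) t *\<^sub>R z t x)
      = real (Suc m) *\<^sub>R F m (Suc k) x - real (Suc k) *\<^sub>R F (Suc m) k x" if x: "x \<in> {0..l}" for m k x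
  proof -
    have dg: "(g (Suc m) (Suc k) has_real_derivative
        (real (Suc k) * g (Suc m) k t - real (Suc m) * g m (Suc k) t)) (at t within S)" for t S
      unfolding g_def by (auto intro!: derivative_eq_intros simp: algebra_simps simp del: power_Suc)
    have "((\<lambda>t. g (Suc m) (Suc k) t *\<^sub>R z t x + (real (Suc k) * g (Suc m) k t - real (Suc m) * g m (Suc k) t) *\<^sub>R v t x)
       has_integral (g (Suc m) (Suc k) d *\<^sub>R v d x - g (Suc m) (Suc k) 0 *\<^sub>R v 0 x)) {0..d}"
      using d x sub
      by (intro fundamental_theorem_of_calculus has_vector_derivative_scaleR dg
            has_vector_derivative_within_subset[OF dt sub]) auto
    then have 1: "integral {0..d} (\<lambda>t. g (Suc m) (Suc k) t *\<^sub>R z t x + (real (Suc k) * g (Suc m) k t - real (Suc m) * g m (Suc k) t) *\<^sub>R v t x) = 0"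
      by (simp add: integral_unique g_def)
    have i: "(\<lambda>t. g i j t *\<^sub>R z t x) integrable_on {0..d}" "(\<lambda>t. g i j t *\<^sub>R v t x) integrable_on {0..d}" for i j
      using x sub by (auto intro!: integrable_continuous_real continuous_intros cg)
    have "((\<lambda>t. g (Suc m) (Suc k) t *\<^sub>R z t x + (real (Suc k) *\<^sub>R (g (Suc m) k t *\<^sub>R v t x) - real (Suc m) *\<^sub>R (g m (Suc k) t *\<^sub>R v t x)))
       has_integral (integral {0..d} (\<lambda>t. g (Suc m) (Suc k) t *\<^sub>R z t x) + (real (Suc k) *\<^sub>R F (Suc m) k x - real (Suc m) *\<^sub>R F m (Suc k) x))) {0..d}"
      unfolding F_def
      by (intro has_integral_add has_integral_diff has_integral_cmul integrable_integral i)
    from integral_unique[OF this] 1 show ?thesis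
      by (simp add: scaleR_diff_left algebra_simps del: of_nat_Suc)
  qed
  \<comment> \<open>Because \<open>Q\<close> does not depend on time, integrating against the weight
    yields a Volterra equation in \<open>x\<close> for the moments alone, with \<open>z\<close>
    removed by \<open>parts\<close>.\<close>
  have F_eq: "F (Suc m) (Suc k) x = integral {0..x} (\<lambda>y. (x - y) *\<^sub>R (Q y * F (Suc m) (Suc k) y
      + \<i> * (real (Suc m) *\<^sub>R F m (Suc k) y - real (Suc k) *\<^sub>R F (Suc m) k y)))" if x: "x \<in> {0..l}" for m k x
  proof -
    let ?g = "g (Suc m) (Suc k)"
    have "F (Suc m) (Suc k) x = integral {0..d} (\<lambda>t. integral {0..x} (\<lambda>y. ?g t *\<^sub>R ((x - y) *\<^sub>R (Q y * v t y + \<i> * z t y))))"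
      unfolding F_def
    proof (rule integral_cong)
      fix t assume "t \<in> {0..d}"
      then have t: "t \<in> {0..T}" using sub by auto
      show "?g t *\<^sub>R v t x = integral {0..x} (\<lambda>y. ?g t *\<^sub>R ((x - y) *\<^sub>R (Q y * v t y + \<i> * z t y)))"
        by (subst eq[OF t x]) (simp only: integral_cmul)
    qed
    also have "\<dots> = integral {0..x} (\<lambda>y. integral {0..d} (\<lambda>t. ?g t *\<^sub>R ((x - y) *\<^sub>R (Q y * v t y + \<i> * z t y))))"
    proof -
      have "continuous_on ({0..d} \<times> {0..x}) (\<lambda>(t, y). ?g t *\<^sub>R ((x - y) *\<^sub>R (Q y * v t y + \<i> * z t y)))"
        using x sub unfolding case_prod_unfold g_def by (auto intro!: continuous_intros)
      then show ?thesis
        using integral_swap_continuous[of 0 0 d x "\<lambda>t y. ?g t *\<^sub>R ((x - y) *\<^sub>R (Q y * v t y + \<i> * z t y))"]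
        by (simp add: cbox_Pair_eq)
    qed
    also have "\<dots> = integral {0..x} (\<lambda>y. (x - y) *\<^sub>R (Q y * F (Suc m) (Suc k) y
      + \<i> * (real (Suc m) *\<^sub>R F m (Suc k) y - real (Suc k) *\<^sub>R F (Suc m) k y)))"
    proof (rule integral_cong)
      fix y assume "y \<in> {0..x}"
      then have y: "y \<in> {0..l}" using x by auto
      have i: "(\<lambda>t. ?g t *\<^sub>R z t y) integrable_on {0..d}" "(\<lambda>t. ?g t *\<^sub>R v t y) integrable_on {0..d}"
        using y sub by (auto intro!: integrable_continuous_real continuous_intros cg)
      have "((\<lambda>t. (x - y) *\<^sub>R (Q y * (?g t *\<^sub>R v t y) + \<i> * (?g t *\<^sub>R z t y))) has_integral
         (x - y) *\<^sub>R (Q y * F (Suc m) (Suc k) y + \<i> * integral {0..d} (\<lambda>t. ?g t *\<^sub>R z t y))) {0..d}"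
        unfolding F_def
        by (intro has_integral_add has_integral_cmul has_integral_mult_right integrable_integral i)
      moreover have "(\<lambda>t. (x - y) *\<^sub>R (Q y * (?g t *\<^sub>R v t y) + \<i> * (?g t *\<^sub>R z t y)))
         = (\<lambda>t. ?g t *\<^sub>R ((x - y) *\<^sub>R (Q y * v t y + \<i> * z t y)))"
        by (simp add: fun_eq_iff algebra_simps)
      ultimately show "integral {0..d} (\<lambda>t. ?g t *\<^sub>R ((x - y) *\<^sub>R (Q y * v t y + \<i> * z t y)))
         = (x - y) *\<^sub>R (Q y * F (Suc m) (Suc k) y + \<i> * (real (Suc m) *\<^sub>R F m (Suc k) y - real (Suc k) *\<^sub>R F (Suc m) k y))"
        unfolding parts[OF y] by (simp only: integral_unique)
    qed
    finally show ?thesis .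
  qed
  \<comment> \<open>The price of one application of Gronwall's inequality, which removes the
    \<open>Q\<close> term at each induction step.\<close>
  define C where "C = exp (l * M * l)"
  have C: "C \<ge> 0" by (simp add: C_def)
  \<comment> \<open>\<open>n\<close> counts the integrations by parts. Each costs at most
    \<open>m + k\<close> and gains two powers of \<open>x\<close>; the exponents only decrease, so
    the initial \<open>m + k\<close> dominates throughout.\<close>
  have F_decay: "norm (F m k x) \<le> A * (C * (real m + real k)) ^ n * x ^ (2 * n) / fact (2 * n)"
    if "n \<le> m" "n \<le> k" "x \<in> {0..l}" for n m k x
    using that
  proof (induction n arbitrary: m k x)
    case 0
    then show ?case using F_bound by simp
  next
    case (Suc n)
    obtain m' k' where mk: "m = Suc m'" "k = Suc k'" using Suc.prems by (meson Suc_le_D)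
    define s where "s = real m + real k"
    have s: "0 \<le> s" by (simp add: s_def)
    define D where "D = A * (C * s) ^ n"
    have D: "0 \<le> D" using A0 C s by (simp add: D_def)
    have b1: "norm (F m' k y) \<le> D * (y ^ (2 * n) / fact (2 * n))"
      and b2: "norm (F m k' y) \<le> D * (y ^ (2 * n) / fact (2 * n))" if y: "y \<in> {0..l}" for y
    proof -
      have *: "A * (C * r) ^ n * y ^ (2 * n) / fact (2 * n) \<le> D * (y ^ (2 * n) / fact (2 * n))"
        if "0 \<le> r" "r \<le> s" for r
        unfolding D_def times_divide_eq_right
        by (intro divide_right_mono mult_right_mono mult_left_mono power_mono) (use that C A0 y in auto)
      show "norm (F m' k y) \<le> D * (y ^ (2 * n) / fact (2 * n))"
        using Suc.IH[of m' k y] *[of "real m' + real k"] Suc.prems y by (simp add: mk s_def)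
      show "norm (F m k' y) \<le> D * (y ^ (2 * n) / fact (2 * n))"
        using Suc.IH[of m k' y] *[of "real m + real k'"] Suc.prems y by (simp add: mk s_def)
    qed
    define G where "G = s * D * (x ^ (2 * n + 2) / fact (2 * n + 2))"
    have x: "0 \<le> x" "x \<le> l" using Suc.prems by auto
    have "norm (F m k x) \<le> G * exp (l * M * x)"
    proof (rule gronwall)
      show "continuous_on {0..x} (\<lambda>x. norm (F m k x))"
        using x by (intro continuous_intros continuous_on_subset[OF cF]) auto
      fix y assume y: "0 \<le> y" "y \<le> x"
      have "norm (F m k y) \<le> integral {0..y} (\<lambda>r. l * M * norm (F m k r) + s * D * ((y - r) * (r ^ (2 * n) / fact (2 * n))))"
        unfolding mk F_eq[of y m' k', OF atLeastAtMost_iff[THEN iffD2, OF conjI[OF y(1) order_trans[OF y(2) x(2)]]]]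
      proof (rule integral_norm_bound_integral, goal_cases)
        case 1
        show ?case
          using x y by (intro integrable_continuous_real continuous_intros continuous_on_subset[OF cF] continuous_on_subset[OF cQ]) auto
      next
        case 2
        show ?case
          using x y by (intro integrable_continuous_real continuous_intros continuous_on_subset[OF cF]) auto
      next
        case (3 r)
        then have r: "r \<in> {0..l}" "r \<le> y" using x y by auto
        have "norm (Q r * F m k r + \<i> * (real m *\<^sub>R F m' k r - real k *\<^sub>R F m k' r))
          \<le> norm (Q r) * norm (F m k r) + (real m * norm (F m' k r) + real k * norm (F m k' r))"
          using norm_triangle_ineq[of "Q r * F m k r" "\<i> * (real m *\<^sub>R F m' k r - real k *\<^sub>R F m k' r)"]
            norm_triangle_ineq4[of "real m *\<^sub>R F m' k r" "real k *\<^sub>R F m k' r"]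
          by (simp add: norm_mult)
        also have "\<dots> \<le> M * norm (F m k r) + (real m * (D * (r ^ (2 * n) / fact (2 * n))) + real k * (D * (r ^ (2 * n) / fact (2 * n))))"
          by (intro add_mono mult_mono M M0 b1 b2 r) auto
        also have "\<dots> = M * norm (F m k r) + s * D * (r ^ (2 * n) / fact (2 * n))"
          by (simp add: s_def algebra_simps add_divide_distrib)
        finally have "norm ((y - r) *\<^sub>R (Q r * F m k r + \<i> * (real m *\<^sub>R F m' k r - real k *\<^sub>R F m k' r)))
          \<le> (y - r) * (M * norm (F m k r) + s * D * (r ^ (2 * n) / fact (2 * n)))"
          using r by (simp add: mult_left_mono)
        also have "\<dots> = (y - r) * (M * norm (F m k r)) + s * D * ((y - r) * (r ^ (2 * n) / fact (2 * n)))"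
          by (simp add: algebra_simps)
        also have "(y - r) * (M * norm (F m k r)) \<le> l * (M * norm (F m k r))"
          using r y x M0 by (intro mult_right_mono) auto
        finally show ?case by (simp add: mk mult.assoc)
      qed
      also have "\<dots> = l * M * integral {0..y} (\<lambda>r. norm (F m k r)) + s * D * (y ^ (2 * n + 2) / fact (2 * n + 2))"
        using x y
        by (subst Henstock_Kurzweil_Integration.integral_add)
           (auto intro!: integrable_continuous_real continuous_intros continuous_on_subset[OF cF]
             simp: integral_monomial_taylor simp del: times_divide_eq_right fact_Suc)
      also have "s * D * (y ^ (2 * n + 2) / fact (2 * n + 2)) \<le> G"
        unfolding G_def using y s D by (intro mult_left_mono divide_right_mono power_mono) auto
      finally show "norm (F m k y) \<le> G + l * M * integral {0..y} (\<lambda>r. norm (F m k r))" by simp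
    qed (use x M0 in auto)
    also have "\<dots> \<le> G * C"
    proof (rule mult_left_mono)
      show "exp (l * M * x) \<le> C"
        using x M0 by (simp add: C_def mult_left_mono)
      show "0 \<le> G"
        unfolding G_def using x s D by (intro mult_nonneg_nonneg divide_nonneg_nonneg) auto
    qed
    also have "\<dots> = A * (C * s) ^ Suc n * x ^ (2 * Suc n) / fact (2 * Suc n)"
      by (simp add: G_def D_def mult_ac del: fact_Suc)
    finally show ?case by (simp add: s_def)
  qed
  have ig: "g n n integrable_on {0..d}" for n by (intro integrable_continuous_real cg)
  have lower: "e * (d / 3 * (d / 3) ^ (2 * n)) \<le> norm (F n n x0)" for n
  proof -
    have "norm (F n n x0 - integral {0..d} (g n n) *\<^sub>R v 0 x0) \<le> integral {0..d} (\<lambda>t. e * g n n t)"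
    proof -
      have i: "(\<lambda>t. g n n t *\<^sub>R v t x0) integrable_on {0..d}"
        using x0 sub by (auto intro!: integrable_continuous_real continuous_intros cg)
      have D: "((\<lambda>t. g n n t *\<^sub>R v t x0 - g n n t *\<^sub>R v 0 x0) has_integral (F n n x0 - integral {0..d} (g n n) *\<^sub>R v 0 x0)) {0..d}"
        unfolding F_def by (intro has_integral_diff has_integral_scaleR_left integrable_integral i ig)
      have "norm (g n n t *\<^sub>R v t x0 - g n n t *\<^sub>R v 0 x0) \<le> e * g n n t" if t: "t \<in> {0..d}" for t
      proof -
        have "norm (v t x0 - v 0 x0) \<le> e" using d0(2)[of t] t d by auto
        from mult_left_mono[OF this g(1)[OF t, of n n]] show ?thesis
          using g(1)[OF t, of n n] by (simp add: mult.commute flip: scaleR_diff_right)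
      qed
      then have "norm (integral {0..d} (\<lambda>t. g n n t *\<^sub>R v t x0 - g n n t *\<^sub>R v 0 x0)) \<le> integral {0..d} (\<lambda>t. e * g n n t)"
        by (intro integral_norm_bound_integral has_integral_integrable[OF D] integrable_continuous_real continuous_intros cg)
      then show ?thesis
        unfolding integral_unique[OF D] .
    qed
    then have "norm (integral {0..d} (g n n) *\<^sub>R v 0 x0) - norm (F n n x0) \<le> e * integral {0..d} (g n n)"
      using norm_triangle_ineq2[of "integral {0..d} (g n n) *\<^sub>R v 0 x0" "F n n x0"]
      by (simp add: norm_minus_commute)
    moreover have "0 \<le> integral {0..d} (g n n)" by (rule integral_nonneg[OF ig g(1)])
    ultimately have "e * integral {0..d} (g n n) \<le> norm (F n n x0)"
      by (simp add: e_def field_simps)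
    \<comment> \<open>On the middle third of \<open>{0..d}\<close> both \<open>t\<close> and
      \<open>d - t\<close> are at least \<open>d / 3\<close>.\<close>
    moreover have "d / 3 * (d / 3) ^ (2 * n) \<le> integral {0..d} (g n n)"
    proof -
      have *: "b * b ^ (2 * n) = integral {b..2 * b} (\<lambda>t. b ^ n * b ^ n)" if "0 \<le> b" for b :: real
        using that by (simp only: integral_const_real power_add mult_2) simp
      have "d / 3 * (d / 3) ^ (2 * n) = integral {d / 3..2 * (d / 3)} (\<lambda>t. (d / 3) ^ n * (d / 3) ^ n)"
        by (rule *) (use d in simp)
      also have "integral {d / 3..2 * (d / 3)} (\<lambda>t. (d / 3) ^ n * (d / 3) ^ n) \<le> integral {d / 3..2 * (d / 3)} (g n n)"
        unfolding g_def using d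
        by (intro integral_le mult_mono power_mono integrable_continuous_real continuous_intros) auto
      also have "\<dots> \<le> integral {0..d} (g n n)"
        using d g(1) by (intro integral_subset_le integrable_continuous_real cg) auto
      finally show ?thesis .
    qed
    ultimately show ?thesis using e by (meson less_imp_le mult_left_mono order_trans)
  qed
  \<comment> \<open>The 2 stems from \<open>m + k = 2 * n\<close>, the denominator from the lower
    bound; the comparison becomes a fixed positive number against
    \<open>q ^ n / fact n\<close>.\<close>
  define q where "q = 2 * C * x0\<^sup>2 / (d / 3)\<^sup>2"
  have "e * (d / 3) \<le> A * (q ^ n / fact n)" for n
  proof -
    have d3: "0 < (d / 3) ^ (2 * n)" using d by simp
    have "e * (d / 3) * (d / 3) ^ (2 * n) \<le> A * (C * (real n + real n)) ^ n * x0 ^ (2 * n) / fact (2 * n)"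
      using order_trans[OF lower[of n] F_decay[OF order_refl order_refl x0, of n]] by (simp add: mult.assoc)
    also have "\<dots> = A * (2 * C * x0\<^sup>2) ^ n * (real n ^ n / fact (2 * n))"
      by (simp add: power_mult_distrib power_mult flip: mult_2)
    also have "\<dots> \<le> A * (2 * C * x0\<^sup>2) ^ n * (1 / fact n)"
    proof (rule mult_left_mono)
      show "real n ^ n / fact (2 * n) \<le> 1 / fact n"
        using power_mult_fact_le[of n n] unfolding mult_2 by (simp add: divide_simps mult.commute)
      show "0 \<le> A * (2 * C * x0\<^sup>2) ^ n" using A0 C by simp
    qed
    also have "(2 * C * x0\<^sup>2) ^ n = q ^ n * (d / 3) ^ (2 * n)"
      unfolding power_mult power_mult_distrib[symmetric] q_def using d by simp
    also have "A * (q ^ n * (d / 3) ^ (2 * n)) * (1 / fact n) = A * (q ^ n / fact n) * (d / 3) ^ (2 * n)"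
      by simp
    finally show ?thesis using d3 by (simp only: mult_le_cancel_right_pos)
  qed
  note le = this
  have "(\<lambda>n. q ^ n / fact n) \<longlonglongrightarrow> 0"
    using summable_LIMSEQ_zero[OF summable_exp[of q]] by (simp add: field_simps)
  then have "(\<lambda>n. A * (q ^ n / fact n)) \<longlonglongrightarrow> A * 0"
    by (intro tendsto_intros)
  then have "e * (d / 3) \<le> A * 0"
    by (rule LIMSEQ_le_const) (use le in blast)
  then show False using e d by (simp add: mult_le_0_iff)
qed

subsection \<open>Even extensions and the inverse problem\<close>

text \<open>Freezing the value beyond \<open>l\<close> gives a bounded continuous function on the
  line without touching \<open>{-l..l}\<close>, the only part that \<open>S\<close> reads.\<close>

definition even_ext :: "real \<Rightarrow> (real \<Rightarrow> complex) \<Rightarrow> (real \<Rightarrow>\<^sub>C complex)" where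
  "even_ext l w = Bcontfun (\<lambda>y. w (min \<bar>y\<bar> l))"

lemma even_ext_apply:
  assumes "0 \<le> l" "continuous_on {0..l} w"
  shows "even_ext l w y = w (min \<bar>y\<bar> l)"
proof -
  have "compact (w ` {0..l})"
    by (intro compact_continuous_image assms(2)) auto
  from compact_imp_bounded[OF this] obtain B where B: "\<forall>x\<in>w ` {0..l}. norm x \<le> B"
    unfolding bounded_iff ..
  have "(\<lambda>y. w (min \<bar>y\<bar> l)) \<in> bcontfun"
    by (rule bcontfun_normI[where b = B], rule continuous_on_compose2[OF assms(2)])
       (use assms(1) B in \<open>auto intro!: continuous_intros\<close>)
  then show ?thesis by (simp add: even_ext_def Bcontfun_inverse)
qed

lemma continuous_on_slice:
  assumes "continuous_on (S \<times> R) (\<lambda>(t, x). u t x)" "t \<in> S"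
  shows "continuous_on R (u t)"
  using continuous_on_compose2[OF assms(1) continuous_on_Pair[OF continuous_on_const[of R t] continuous_on_id]] assms(2)
  by auto

lemma continuous_on_slice2:
  assumes "continuous_on (S \<times> R) (\<lambda>(t, x). u t x)" "x \<in> R"
  shows "continuous_on S (\<lambda>t. u t x)"
  using continuous_on_compose2[OF assms(1) continuous_on_Pair[OF continuous_on_id continuous_on_const[of S x]]] assms(2)
  by auto

text \<open>Continuity in the supremum norm comes from uniform continuity on the compact
  rectangle.\<close>

lemma continuous_on_even_ext:
  assumes "0 \<le> l" "compact S" and c: "continuous_on (S \<times> {0..l}) (\<lambda>(t, x). u t x)"
  shows "continuous_on S (\<lambda>t :: real. even_ext l (u t))"
  unfolding continuous_on_iff
proof (intro ballI allI impI)
  fix t e :: real assume "t \<in> S" "0 < e"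
  have "uniformly_continuous_on (S \<times> {0..l}) (\<lambda>(t, x). u t x)"
    by (intro compact_uniformly_continuous c compact_Times assms(2)) auto
  from uniformly_continuous_onE[OF this, of "e / 2"] \<open>0 < e\<close>
  obtain d where "d > 0"
    and d: "\<And>z z'. z \<in> S \<times> {0..l} \<Longrightarrow> z' \<in> S \<times> {0..l} \<Longrightarrow> dist z' z < d \<Longrightarrow>
       dist (case z' of (t, x) \<Rightarrow> u t x) (case z of (t, x) \<Rightarrow> u t x) < e / 2"
    by (metis half_gt_zero)
  have "continuous_on {0..l} (u t)" if "t \<in> S" for t
    by (rule continuous_on_slice[OF c that])
  then have "dist (even_ext l (u t') y) (even_ext l (u t) y) \<le> e / 2" if "t' \<in> S" "dist t' t < d" for t' y
    using d[of "(t, min \<bar>y\<bar> l)" "(t', min \<bar>y\<bar> l)"] that \<open>t \<in> S\<close> assms(1)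
    by (simp add: even_ext_apply dist_Pair_Pair)
  then have "dist (even_ext l (u t')) (even_ext l (u t)) \<le> e / 2" if "t' \<in> S" "dist t' t < d" for t'
    using that by (intro dist_bound) auto
  then show "\<exists>d>0. \<forall>t'\<in>S. dist t' t < d \<longrightarrow> dist (even_ext l (u t')) (even_ext l (u t)) < e"
    using \<open>d > 0\<close> \<open>0 < e\<close> by (intro exI[of _ d]) force
qed

lemma taylor_interval:
  fixes w :: "real \<Rightarrow> complex"
  assumes w: "\<And>x. x \<in> {0..l} \<Longrightarrow> (w has_vector_derivative w1 x) (at x within {0..l})"
    and w1: "\<And>x. x \<in> {0..l} \<Longrightarrow> (w1 has_vector_derivative w2 x) (at x within {0..l})"
    and "w1 0 = 0" "y \<in> {0..l}"
  shows "((\<lambda>s. (y - s) *\<^sub>R w2 s) has_integral (w y - w 0)) {0..y}"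
proof -
  have sub: "{0..y} \<subseteq> {0..l}" using assms(4) by auto
  have "((\<lambda>s. (y - s) *\<^sub>R w2 s) has_integral (((y - y) *\<^sub>R w1 y + w y) - ((y - 0) *\<^sub>R w1 0 + w 0))) {0..y}"
  proof (rule fundamental_theorem_of_calculus)
    fix s assume s: "s \<in> {0..y}"
    note d = has_vector_derivative_within_subset[OF w sub] has_vector_derivative_within_subset[OF w1 sub]
    show "((\<lambda>s. (y - s) *\<^sub>R w1 s + w s) has_vector_derivative (y - s) *\<^sub>R w2 s) (at s within {0..y})"
      using s sub by (auto intro!: derivative_eq_intros d)
  qed (use assms(4) in auto)
  then show ?thesis using assms(3) by simp
qed

lemma prim_prim_even:
  fixes f :: "real \<Rightarrow> complex"
  assumes "\<And>x. f (- x) = f x"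
  shows "prim (prim f) (- y) = prim (prim f) y"
proof -
  have *: "prim f (- x) = - prim f x" for x
    using prim_minus[of f x] assms by simp
  have "prim (\<lambda>x. - prim f x) y = - prim (prim f) y"
    by (simp add: prim_def[of "\<lambda>x. - prim f x"] prim_def[of "prim f"])
  then show ?thesis
    using prim_minus[of "prim f" y] by (simp add: *)
qed

text \<open>The Neumann condition enters here: otherwise reflection would leave a term
  \<open>\<bar>y\<bar> *\<^sub>R w1 0\<close>, a kink at the origin.\<close>

lemma even_ext_taylor:
  fixes w :: "real \<Rightarrow> complex"
  assumes "0 \<le> l"
    and w: "\<And>x. x \<in> {0..l} \<Longrightarrow> (w has_vector_derivative w1 x) (at x within {0..l})"
    and w1: "\<And>x. x \<in> {0..l} \<Longrightarrow> (w1 has_vector_derivative w2 x) (at x within {0..l})"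
    and w2: "continuous_on {0..l} w2"
    and "w1 0 = 0" "\<bar>y\<bar> \<le> l"
  shows "even_ext l w y = even_ext l w 0 + prim (prim (even_ext l w2)) y"
proof -
  have cw: "continuous_on {0..l} w"
    using has_vector_derivative_continuous[OF w] by (simp add: continuous_on_eq_continuous_within)
  have *: "even_ext l w y = even_ext l w 0 + prim (prim (even_ext l w2)) y" if y: "y \<in> {0..l}" for y
  proof -
    have "prim (prim (even_ext l w2)) y = integral {0..y} (\<lambda>s. (y - s) *\<^sub>R even_ext l w2 s)"
      using y by (simp add: prim_taylor)
    also have "\<dots> = integral {0..y} (\<lambda>s. (y - s) *\<^sub>R w2 s)"
      using y assms(1) w2 by (intro integral_cong) (simp add: even_ext_apply)
    also have "\<dots> = w y - w 0"
      by (rule integral_unique[OF taylor_interval[OF w w1 assms(5) y]])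
    finally show ?thesis
      using y assms(1) cw by (simp add: even_ext_apply)
  qed
  have "even_ext l w y = even_ext l w \<bar>y\<bar>"
    using assms(1) cw by (simp add: even_ext_apply)
  moreover have "prim (prim (even_ext l w2)) \<bar>y\<bar> = prim (prim (even_ext l w2)) y"
    using prim_prim_even[of "even_ext l w2" y] assms(1) w2 by (cases "y \<ge> 0") (auto simp: even_ext_apply)
  ultimately show ?thesis
    using *[of "\<bar>y\<bar>"] assms(6) by simp
qed

text \<open>The integral is the twofold primitive of \<open>k\<close>; differentiating it twice
  within the interval, where derivatives are unique even at the end points, recovers
  \<open>k\<close>.\<close>

lemma double_integral_eq_0:
  fixes k :: "real \<Rightarrow> complex"
  assumes "0 < l" "continuous_on {0..l} k"
    and 0: "\<And>x. x \<in> {0..l} \<Longrightarrow> integral {0..x} (\<lambda>s. (x - s) *\<^sub>R k s) = 0"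
    and x: "x \<in> {0..l}"
  shows "k x = 0"
proof -
  define K where "K = apply_bcontfun (even_ext l k)"
  have K: "K x = k x" if "x \<in> {0..l}" for x
    using that assms by (simp add: K_def even_ext_apply)
  have cK: "continuous_on S K" for S by (simp add: K_def)
  have zero: "g x = 0" if "\<And>x. (f has_vector_derivative g x) (at x within {0..l})"
      "\<And>x. x \<in> {0..l} \<Longrightarrow> f x = 0" "x \<in> {0..l}" for f g :: "real \<Rightarrow> complex" and x
  proof -
    have "((\<lambda>x. 0) has_vector_derivative g x) (at x within {0..l})"
      by (rule has_vector_derivative_transform[OF that(3) _ that(1)]) (simp add: that(2))
    then show ?thesis
      using vector_derivative_unique_within_closed_interval[of 0 l x "\<lambda>x. 0" "g x" 0] assms(1) that(3) by simp
  qed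
  have "prim (prim K) x = 0" if "x \<in> {0..l}" for x
  proof -
    have "prim (prim K) x = integral {0..x} (\<lambda>s. (x - s) *\<^sub>R K s)"
      using that by (simp add: prim_taylor cK)
    also have "\<dots> = integral {0..x} (\<lambda>s. (x - s) *\<^sub>R k s)"
      by (rule integral_cong) (use K that in auto)
    finally show ?thesis using 0[OF that] by simp
  qed
  then have "prim K x = 0" if "x \<in> {0..l}" for x
    by (rule zero[OF prim_has_derivative[OF prim_continuous[OF cK]] _ that])
  then have "K x = 0"
    by (rule zero[OF prim_has_derivative[OF cK] _ x])
  then show ?thesis using K x by simp
qed

text \<open>Pointwise time derivatives do not pass through \<open>S\<close>; a derivative in the
  supremum norm does. It comes from writing the extension as an integral in the function space, an
  identity that can be checked by evaluation.\<close>

lemma even_ext_has_vector_derivative: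
  fixes u ut :: "real \<Rightarrow> real \<Rightarrow> complex"
  assumes "0 \<le> l"
    and cu: "\<And>t. t \<in> {0..T} \<Longrightarrow> continuous_on {0..l} (u t)"
    and cut: "continuous_on ({0..T} \<times> {0..l}) (\<lambda>(t, x). ut t x)"
    and dt: "\<And>t x. t \<in> {0..T} \<Longrightarrow> x \<in> {0..l} \<Longrightarrow> ((\<lambda>t. u t x) has_vector_derivative ut t x) (at t within {0..T})"
    and t: "t \<in> {0..T}"
  shows "((\<lambda>t. even_ext l (u t)) has_vector_derivative even_ext l (ut t)) (at t within {0..T})"
proof -
  have c: "continuous_on {0..T} (\<lambda>t. even_ext l (ut t))"
    by (rule continuous_on_even_ext[OF assms(1) _ cut]) simp
  have ct: "continuous_on {0..l} (ut t)" if "t \<in> {0..T}" for t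
    by (rule continuous_on_slice[OF cut that])
  have eq: "even_ext l (u t) = even_ext l (u 0) + integral {0..t} (\<lambda>s. even_ext l (ut s))" if t: "t \<in> {0..T}" for t
  proof (rule bcontfun_eqI)
    fix y
    define x where "x = min \<bar>y\<bar> l"
    have x: "x \<in> {0..l}" using assms(1) by (simp add: x_def)
    have sub: "{0..t} \<subseteq> {0..T}" using t by auto
    have "(\<lambda>s. even_ext l (ut s)) integrable_on {0..t}"
      by (rule integrable_continuous_real[OF continuous_on_subset[OF c sub]])
    from integral_linear[OF this bounded_linear_bcontfun_eval[of y]]
    have "integral {0..t} (\<lambda>s. even_ext l (ut s)) y = integral {0..t} (\<lambda>s. even_ext l (ut s) y)"
      by (simp add: o_def)
    also have "\<dots> = integral {0..t} (\<lambda>s. ut s x)"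
      using sub by (intro integral_cong) (auto simp: even_ext_apply assms(1) ct x_def)
    also have "\<dots> = u t x - u 0 x"
      using t sub by (intro integral_unique fundamental_theorem_of_calculus has_vector_derivative_within_subset[OF dt[OF _ x] sub]) auto
    finally show "even_ext l (u t) y = (even_ext l (u 0) + integral {0..t} (\<lambda>s. even_ext l (ut s))) y"
      using t by (simp add: even_ext_apply assms(1) cu x_def)
  qed
  have "((\<lambda>t. even_ext l (u 0) + integral {0..t} (\<lambda>s. even_ext l (ut s))) has_vector_derivative 0 + even_ext l (ut t)) (at t within {0..T})"
    by (rule has_vector_derivative_add[OF has_vector_derivative_const integral_has_vector_derivative[OF c t]])
  from has_vector_derivative_transform[OF t eq this] show ?thesis by simp
qed

section \<open>Extending the equations to the closed rectangle\<close>

lemma continuous_zero_closed_rectangle: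
  fixes h :: "real \<Rightarrow> real \<Rightarrow> complex"
  assumes "0 < T" "0 < l" "continuous_on ({0..T} \<times> {0..l}) (\<lambda>(t, x). h t x)"
    and "\<And>t x. 0 < t \<Longrightarrow> t < T \<Longrightarrow> 0 < x \<Longrightarrow> x < l \<Longrightarrow> h t x = 0"
    and "t \<in> {0..T}" "x \<in> {0..l}"
  shows "h t x = 0"
proof -
  have "closure ({0<..<T} \<times> {0<..<l}) = {0..T} \<times> {0..l}"
    using assms(1,2) by (simp add: closure_Times)
  then show ?thesis
    using continuous_constant_on_closure[of "{0<..<T} \<times> {0<..<l}" "\<lambda>(t, x). h t x" 0 "(t, x)"] assms
    by auto
qed

lemma continuous_zero_closed_interval:
  fixes h :: "real \<Rightarrow> complex"
  assumes "0 < T" "continuous_on {0..T} h" "\<And>t. 0 < t \<Longrightarrow> t < T \<Longrightarrow> h t = 0" "t \<in> {0..T}"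
  shows "h t = 0"
  using continuous_constant_on_closure[of "{0<..<T}" h 0 t] assms by auto


text \<open>The equations are assumed in the open rectangle, but the argument uses them at
  \<open>t = 0\<close> and down to \<open>x = 0\<close>; continuity of all terms carries them
  there.\<close>

lemma schroedinger_closed:
  fixes u :: "real \<Rightarrow> real \<Rightarrow> complex"
  assumes "0 < T" "0 < l" and u: "u \<in> C12 T l" and P: "continuous_on {0..l} P"
    and eq: "\<And>t x. 0 < t \<Longrightarrow> t < T \<Longrightarrow> 0 < x \<Longrightarrow> x < l \<Longrightarrow>
           \<i> * partial_t T u t x = partial_x l (partial_x l u) t x - P x * u t x"
    and bc: "\<And>t. 0 < t \<Longrightarrow> t < T \<Longrightarrow> partial_x l u t 0 = 0"
    and t: "t \<in> {0..T}"
  shows "x \<in> {0..l} \<Longrightarrow> partial_x l (partial_x l u) t x = P x * u t x + \<i> * partial_t T u t x"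
    and "partial_x l u t 0 = 0"
proof -
  have c: "continuous_on ({0..T} \<times> {0..l}) (\<lambda>z. u (fst z) (snd z))"
      "continuous_on ({0..T} \<times> {0..l}) (\<lambda>z. partial_t T u (fst z) (snd z))"
      "continuous_on ({0..T} \<times> {0..l}) (\<lambda>z. partial_x l (partial_x l u) (fst z) (snd z))"
    and cx: "continuous_on ({0..T} \<times> {0..l}) (\<lambda>(t, x). partial_x l u t x)"
    using u by (auto simp: C12_def case_prod_unfold)
  have cP: "continuous_on ({0..T} \<times> {0..l}) (\<lambda>z. P (snd z))"
    by (rule continuous_on_compose2[OF P]) (auto intro!: continuous_intros)
  show "partial_x l (partial_x l u) t x = P x * u t x + \<i> * partial_t T u t x" if "x \<in> {0..l}"
  proof -
    have "\<i> * partial_t T u t x - (partial_x l (partial_x l u) t x - P x * u t x) = 0"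
      by (rule continuous_zero_closed_rectangle[OF assms(1,2) _ _ t that])
         (use eq in \<open>auto simp: case_prod_unfold intro!: continuous_intros c cP\<close>)
    then show ?thesis by (simp add: algebra_simps)
  qed
  show "partial_x l u t 0 = 0"
    by (rule continuous_zero_closed_interval[OF assms(1) continuous_on_slice2[OF cx] bc t]) (use assms(2) in auto)
qed

lemma C12_derivatives:
  assumes "u \<in> C12 T l" "t \<in> {0..T}" "x \<in> {0..l}"
  shows "((\<lambda>t. u t x) has_vector_derivative partial_t T u t x) (at t within {0..T})"
    and "(u t has_vector_derivative partial_x l u t x) (at x within {0..l})"
    and "(partial_x l u t has_vector_derivative partial_x l (partial_x l u) t x) (at x within {0..l})"
proof -
  have "(\<lambda>s. u s x) differentiable (at t within {0..T})"
       "(\<lambda>y. u t y) differentiable (at x within {0..l})"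
       "(\<lambda>y. partial_x l u t y) differentiable (at x within {0..l})"
    using assms by (auto simp: C12_def)
  then show "((\<lambda>t. u t x) has_vector_derivative partial_t T u t x) (at t within {0..T})"
    and "(u t has_vector_derivative partial_x l u t x) (at x within {0..l})"
    and "(partial_x l u t has_vector_derivative partial_x l (partial_x l u) t x) (at x within {0..l})"
    unfolding vector_derivative_works partial_t_def[of T u t x] partial_x_def[of l u t x]
      partial_x_def[of l "partial_x l u" t x] .
qed

theorem corollary3:
  fixes l T :: real
    and P Q :: "real \<Rightarrow> complex"
    and u u' :: "real \<Rightarrow> real \<Rightarrow> complex"
    and a :: "real \<Rightarrow> real"
  assumes "l > 0" and "T > 0"
    and "P \<in> C1_interval l" and "Q \<in> C1_interval l"
    and "u \<in> C12 T l" and "u' \<in> C12 T l"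
    and "\<And>t x. 0 < t \<Longrightarrow> t < T \<Longrightarrow> 0 < x \<Longrightarrow> x < l \<Longrightarrow>
           \<i> * partial_t T u t x = partial_x l (partial_x l u) t x - P x * u t x"
    and "\<And>t. 0 < t \<Longrightarrow> t < T \<Longrightarrow> partial_x l u t 0 = 0"
    and "\<And>t x. 0 < t \<Longrightarrow> t < T \<Longrightarrow> 0 < x \<Longrightarrow> x < l \<Longrightarrow>
           \<i> * partial_t T u' t x = partial_x l (partial_x l u') t x - Q x * u' t x"
    and "\<And>t. 0 < t \<Longrightarrow> t < T \<Longrightarrow> partial_x l u' t 0 = 0"
    and "\<And>t. 0 < t \<Longrightarrow> t < T \<Longrightarrow> u t 0 = u' t 0"
    and "a \<in> admissible l"
    and "\<And>x. 0 \<le> x \<Longrightarrow> x \<le> l \<Longrightarrow> u 0 x = complex_of_real (a x)"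
    and "\<And>x. 0 \<le> x \<Longrightarrow> x \<le> l \<Longrightarrow> u' 0 x = complex_of_real (a x)"
  shows "\<forall>x\<in>{0..l}. P x = Q x"
proof -
  note l = assms(1) less_imp_le[OF assms(1)] and T = assms(2) and u = assms(5) and u' = assms(6)
  have C1: "continuous_on {0..l} R" if "R \<in> C1_interval l" for R
    using that by (auto simp: C1_interval_def continuous_on_eq_continuous_within
        intro: differentiable_imp_continuous_within)
  note cP = C1[OF assms(3)] and cQ = C1[OF assms(4)]
  have pde: "partial_x l (partial_x l u) t x = P x * u t x + \<i> * partial_t T u t x"
      "partial_x l u t 0 = 0" if "t \<in> {0..T}" "x \<in> {0..l}" for t x
    by (rule schroedinger_closed[OF T l(1) u cP assms(7,8)]; use that in simp)+
  have pde': "partial_x l (partial_x l u') t x = Q x * u' t x + \<i> * partial_t T u' t x"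
      "partial_x l u' t 0 = 0" if "t \<in> {0..T}" "x \<in> {0..l}" for t x
    by (rule schroedinger_closed[OF T l(1) u' cQ assms(9,10)]; use that in simp)+
  have l0: "0 \<in> {0..l}" using l by simp
  have c: "continuous_on ({0..T} \<times> {0..l}) (\<lambda>(t, x). w t x)"
      "continuous_on ({0..T} \<times> {0..l}) (\<lambda>(t, x). partial_t T w t x)"
      "continuous_on ({0..T} \<times> {0..l}) (\<lambda>(t, x). partial_x l (partial_x l w) t x)"
    if "w \<in> C12 T l" for w
    using that by (auto simp: C12_def)
  note cs = continuous_on_slice[OF c(1)] continuous_on_slice[OF c(2)] continuous_on_slice[OF c(3)]
  define p q where "p = even_ext l P" and "q = even_ext l Q"
  define U D M where "U = (\<lambda>t. even_ext l (u t))" and "D = (\<lambda>t. even_ext l (partial_t T u t))"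
    and "M = (\<lambda>t. even_ext l (partial_x l (partial_x l u) t))"
  \<comment> \<open>\<open>H t\<close> extends \<open>u_xx - P * u\<close>. The equation identifies
    it with \<open>\<i> * D t\<close>, and a time derivative commutes with \<open>S\<close>.\<close>
  define H where "H = (\<lambda>t. M t - bmult p (U t))"
  have H: "H t y = \<i> * D t y" if "t \<in> {0..T}" for t y
    using pde(1)[OF that, of "min \<bar>y\<bar> l"] l that
    by (simp add: H_def M_def U_def D_def p_def even_ext_apply cs[OF u] cP)
  have cU: "continuous_on {0..T} U" and cD: "continuous_on {0..T} D"
    unfolding U_def D_def by (intro continuous_on_even_ext l c[OF u] compact_Icc)+
  let ?S = "transf l p q"
  have cS: "continuous_on ({0..T} \<times> {0..l}) (\<lambda>(t, x). ?S x (V t))" if V: "continuous_on {0..T} V" for V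
  proof -
    have "continuous_on ({0..T} \<times> {0..l}) (\<lambda>z. V (fst z))"
      by (rule continuous_on_compose2[OF V]) (auto intro!: continuous_intros)
    then have 1: "continuous_on ({0..T} \<times> {0..l}) (\<lambda>z. (snd z, V (fst z)))"
      by (intro continuous_intros)
    have 2: "(\<lambda>z. (snd z, V (fst z))) ` ({0..T} \<times> {0..l}) \<subseteq> {0..l} \<times> UNIV" by auto
    from continuous_on_compose2[OF continuous_on_transf[of l p q] 1 2] show ?thesis
      by (simp add: case_prod_unfold)
  qed
  have S_eq: "?S x (U t) = u t 0 + integral {0..x} (\<lambda>s. (x - s) *\<^sub>R (q s * ?S s (U t) + ?S s (H t)))"
    if t: "t \<in> {0..T}" and x: "x \<in> {0..l}" for t x
  proof -
    have "U t y = U t 0 + prim (prim (M t)) y" if "\<bar>y\<bar> \<le> l" for y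
      unfolding U_def M_def
      by (rule even_ext_taylor[OF l(2) C12_derivatives(2)[OF u t] C12_derivatives(3)[OF u t] cs(3)[OF u t] pde(2)[OF t l0] that])
    from transf_eq[OF this, of l x p q] x show ?thesis
      using l t by (simp add: H_def U_def even_ext_apply cs[OF u])
  qed
  have SH: "?S x (H t) = \<i> * ?S x (D t)" if "t \<in> {0..T}" "x \<in> {0..l}" for t x
    by (rule transf_local) (use that H in auto)
  define v z where "v = (\<lambda>t x. ?S x (U t) - u' t x)" and "z = (\<lambda>t x. ?S x (D t) - partial_t T u' t x)"
  have cv: "continuous_on ({0..T} \<times> {0..l}) (\<lambda>(t, x). v t x)"
    and cz: "continuous_on ({0..T} \<times> {0..l}) (\<lambda>(t, x). z t x)"
    using continuous_on_diff[OF cS[OF cU] c(1)[OF u']] continuous_on_diff[OF cS[OF cD] c(2)[OF u']]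
    by (simp_all add: v_def z_def case_prod_unfold)
  have bc: "u t 0 = u' t 0" if "t \<in> {0..T}" for t
  proof -
    have cw: "continuous_on {0..T} (\<lambda>t. w t 0)" if "w \<in> C12 T l" for w
      by (rule continuous_on_slice2[OF c(1)[OF that]]) (use l in auto)
    have "u t 0 - u' t 0 = 0"
      by (rule continuous_zero_closed_interval[OF T continuous_on_diff[OF cw[OF u] cw[OF u']] _ that])
         (simp add: assms(11))
    then show ?thesis by simp
  qed
  \<comment> \<open>\<open>S u\<close> and \<open>u'\<close> satisfy the same twice integrated
    equation with potential \<open>Q\<close>. Their constants are the values at \<open>x = 0\<close>
    and cancel by \<open>bc\<close>, so \<open>v\<close> has zero Cauchy data there.\<close>
  have vz: "v t x = integral {0..x} (\<lambda>y. (x - y) *\<^sub>R (Q y * v t y + \<i> * z t y))"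
    if t: "t \<in> {0..T}" and x: "x \<in> {0..l}" for t x
  proof -
    have sub: "{0..x} \<subseteq> {0..l}" using x by auto
    note cx = continuous_on_subset[OF continuous_on_slice[OF cS[OF cU] t] sub]
      continuous_on_subset[OF continuous_on_slice[OF cS[OF cD] t] sub]
      continuous_on_subset[OF cQ sub]
    have "?S x (U t) - u' t 0 = integral {0..x} (\<lambda>s. (x - s) *\<^sub>R (Q s * ?S s (U t) + \<i> * ?S s (D t)))"
      unfolding S_eq[OF t x] bc[OF t] add_diff_cancel_left'
      by (rule integral_cong) (use sub SH[OF t] l cQ in \<open>auto simp: q_def even_ext_apply\<close>)
    moreover have "(\<lambda>s. (x - s) *\<^sub>R (Q s * ?S s (U t) + \<i> * ?S s (D t))) integrable_on {0..x}"
      by (intro integrable_continuous_real continuous_intros cx)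
    ultimately have 1: "((\<lambda>s. (x - s) *\<^sub>R (Q s * ?S s (U t) + \<i> * ?S s (D t))) has_integral (?S x (U t) - u' t 0)) {0..x}"
      by (simp only: integrable_integral)
    have 2: "((\<lambda>s. (x - s) *\<^sub>R (Q s * u' t s + \<i> * partial_t T u' t s)) has_integral (u' t x - u' t 0)) {0..x}"
      by (rule has_integral_eq[OF _ taylor_interval[OF C12_derivatives(2)[OF u' t] C12_derivatives(3)[OF u' t] pde'(2)[OF t l0] x]])
         (use pde'(1)[OF t] sub in auto)
    have "((\<lambda>s. (x - s) *\<^sub>R (Q s * v t s + \<i> * z t s)) has_integral v t x) {0..x}"
      using has_integral_diff[OF 1 2] by (simp add: v_def z_def algebra_simps)
    then show ?thesis by (simp add: integral_unique)
  qed
  have dv: "((\<lambda>t. v t x) has_vector_derivative z t x) (at t within {0..T})"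
    if t: "t \<in> {0..T}" and x: "x \<in> {0..l}" for t x
  proof -
    have "(U has_vector_derivative D t) (at t within {0..T})"
      unfolding U_def D_def
      by (rule even_ext_has_vector_derivative[OF l(2) cs(1)[OF u] c(2)[OF u] C12_derivatives(1)[OF u] t])
    from bounded_linear.has_vector_derivative[OF bounded_linear_transf this, of x l p q] x
    show ?thesis
      unfolding v_def z_def by (intro has_vector_derivative_diff C12_derivatives(1)[OF u' t x]) auto
  qed
  have v0: "v 0 x = 0" if "x \<in> {0..l}" for x
    by (rule cauchy_uniqueness[OF T l(2) cv cz cQ dv vz that])
  have t0: "0 \<in> {0..T}" using T by simp
  have Sa: "?S x (U 0) = a x" if "x \<in> {0..l}" for x
    using v0[OF that] assms(14)[of x] that by (simp add: v_def)
  have Ua: "U 0 x = a x" if "x \<in> {0..l}" for x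
    using that l assms(13)[of x] by (simp add: U_def even_ext_apply cs(1)[OF u t0])
  \<comment> \<open>\<open>a\<close> now has two Taylor formulas at the origin, one from
    \<open>S a = a\<close> with \<open>Q\<close> and one from \<open>u\<close> with
    \<open>P\<close>. Their difference is a vanishing twofold primitive.\<close>
  have kernel: "(Q x - P x) * a x + (?S x (H 0) - H 0 x) = 0" if x: "x \<in> {0..l}" for x
  proof (rule double_integral_eq_0[OF l(1) _ _ x])
    have ca: "continuous_on {0..l} (\<lambda>x. complex_of_real (a x))"
      by (rule continuous_on_eq[OF cs(1)[OF u t0]]) (use assms(13) in auto)
    have cSH: "continuous_on {0..l} (\<lambda>x. ?S x (H 0))"
      by (rule continuous_on_transf_fixed)
    show "continuous_on {0..l} (\<lambda>x. (Q x - P x) * a x + (?S x (H 0) - H 0 x))"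
      by (intro continuous_intros cP cQ ca cSH)
    fix x assume x: "x \<in> {0..l}"
    then have sub: "{0..x} \<subseteq> {0..l}" by auto
    note cx = continuous_on_subset[OF ca sub] continuous_on_subset[OF cSH sub]
      continuous_on_subset[OF cQ sub] continuous_on_subset[OF cP sub]
    have "a x - u 0 0 = integral {0..x} (\<lambda>s. (x - s) *\<^sub>R (Q s * a s + ?S s (H 0)))"
      unfolding Sa[OF x, symmetric] S_eq[OF t0 x] add_diff_cancel_left'
      by (rule integral_cong) (use sub l cQ Sa in \<open>auto simp: q_def even_ext_apply\<close>)
    moreover have "(\<lambda>s. (x - s) *\<^sub>R (Q s * a s + ?S s (H 0))) integrable_on {0..x}"
      by (intro integrable_continuous_real continuous_intros cx)
    ultimately have 1: "((\<lambda>s. (x - s) *\<^sub>R (Q s * a s + ?S s (H 0))) has_integral (a x - u 0 0)) {0..x}"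
      by (simp only: integrable_integral)
    have M0: "partial_x l (partial_x l u) 0 s = P s * a s + H 0 s" if "s \<in> {0..l}" for s
      using pde(1)[OF t0 that] assms(13)[of s] H[OF t0, of s] that l
      by (simp add: D_def even_ext_apply cs(2)[OF u t0])
    have 2: "((\<lambda>s. (x - s) *\<^sub>R (P s * a s + H 0 s)) has_integral (u 0 x - u 0 0)) {0..x}"
      by (rule has_integral_eq[OF _ taylor_interval[OF C12_derivatives(2)[OF u t0] C12_derivatives(3)[OF u t0] pde(2)[OF t0 l0] x]])
         (use M0 sub in auto)
    have "((\<lambda>s. (x - s) *\<^sub>R ((Q s - P s) * a s + (?S s (H 0) - H 0 s))) has_integral 0) {0..x}"
      using has_integral_diff[OF 1 2] assms(13)[of x] x by (simp add: algebra_simps)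
    then show "integral {0..x} (\<lambda>s. (x - s) *\<^sub>R ((Q s - P s) * a s + (?S s (H 0) - H 0 s))) = 0"
      by (rule integral_unique)
  qed
  have ca: "continuous_on {0..l} a" and apos: "\<And>x. x \<in> {0..l} \<Longrightarrow> 0 < a x"
    using assms(12) by (auto simp: admissible_def)
  obtain x1 where x1: "x1 \<in> {0..l}" "\<And>x. x \<in> {0..l} \<Longrightarrow> a x1 \<le> a x"
    using continuous_attains_inf[OF compact_Icc _ ca] l by auto
  \<comment> \<open>The Volterra bound for \<open>S - 1\<close> divided by the minimum of
    \<open>a\<close>: compactness makes positivity uniform, which yields a homogeneous Gronwall
    inequality.\<close>
  define c where "c = l * exp ((norm q + norm p) * l * l) * norm (H 0) / a x1"
  have c0: "0 \<le> c" unfolding c_def using l apos[OF x1(1)] by simp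
  have small: "norm (Q y - P y) \<le> 0 + c * integral {0..y} (\<lambda>s. norm (Q s - P s))" if y: "y \<in> {0..l}" for y
  proof -
    have I: "integral {0..y} (\<lambda>s. norm (q s - p s)) = integral {0..y} (\<lambda>s. norm (Q s - P s))"
      by (rule integral_cong) (use y l cP cQ in \<open>auto simp: p_def q_def even_ext_apply\<close>)
    have "a x1 * norm (Q y - P y) \<le> norm ((Q y - P y) * a y)"
      using mult_right_mono[OF x1(2)[OF y] norm_ge_zero[of "Q y - P y"]] apos[OF y]
      by (simp add: norm_mult mult.commute)
    also have "\<dots> = norm (?S y (H 0) - H 0 y)"
      using kernel[OF y] by (metis add_eq_0_iff norm_minus_cancel)
    also have "\<dots> \<le> l * exp ((norm q + norm p) * l * l) * norm (H 0) * integral {0..y} (\<lambda>s. norm (Q s - P s))"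
      using transf_diff_bound[of y l p q "H 0"] y unfolding I by simp
    finally show ?thesis
      using apos[OF x1(1)] by (simp add: c_def field_simps)
  qed
  show ?thesis
  proof
    fix x assume x: "x \<in> {0..l}"
    have "norm (Q x - P x) \<le> 0 * exp (c * x)"
    proof (rule gronwall[OF _ c0])
      show "continuous_on {0..x} (\<lambda>s. norm (Q s - P s))"
        using x by (intro continuous_intros continuous_on_subset[OF cP] continuous_on_subset[OF cQ]) auto
    qed (use x small in auto)
    then show "P x = Q x" by simp
  qed
qed

end
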